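(* Let $\mathbf A=\langle A,\supset,\neg\rangle$ be an $I$-algebra. Then: (i) There is an embedding $h:A\to A/{\sim}\times A/{\sim}$ of $\mathbf A$ into the implicative bilattice $\mathbf B=\langle\mathbf A/{\sim}\odot\mathbf A/{\sim},\supset\rangle$ defined, for all $a\in A$, as $h(a)=\langle[a],[\neg a]\rangle$. (ii) $\mathbf B$ is generated by the set $h[A]$. (iii) If $f:A\to B'$ is a homomorphism from $\mathbf A$ to an implicative bilattice $\mathbf B'$, then there is a unique map $f':A/{\sim}\times A/{\sim}\to B'$ which is also a homomorphism from $\mathbf B$ to $\mathbf B'$ such that $f'\cdot h=f$. Moreover, if $f$ is injective, so is $f'$.
   Context: An $I$-algebra is an algebra $\langle A,\supset,\neg\rangle$ satisfying: (I1) $(x\supset x)\supset y\approx y$; (I2) $x\supset(y\supset z)\approx(x\supset y)\supset(x\supset z)\approx y\supset(x\supset z)$; (I3) $((x\supset y)\supset x)\supset x\approx x\supset x$; (I4) $x\supset(\neg y\supset z)\approx\neg(x\supset y)\supset z$; (I5) $\neg\neg x\approx x$; (I6) $p(x,y,x)\approx p(x,y,y)$, where $p(x,y,z)$ is $(x\supset y)\supset((y\supset x)\supset((\neg x\supset\neg y)\supset((\neg y\supset\neg x)\supset z)))$. For an $I$-algebra, $a\sim b$ iff $a\supset b=(a\supset b)\supset(a\supset b)$ and $b\supset a=(b\supset a)\supset(b\supset a)$; equivalently $a\supset c=b\supset c$ for all $c$. This is an equivalence relation compatible with $\supset$; $[a]$ is the class of $a$. On $A/{\sim}$ put $[a]\supset[b]=[a\supset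 b]$, $[a]\lor[b]=([a]\supset[b])\supset[b]$, $[a]\land[b]=[\neg(a\supset\neg b)]$; these are well defined and $\mathbf A/{\sim}=\langle A/{\sim},\land,\lor,\supset\rangle$ is a classical implicative lattice (a relatively complemented distributive lattice with maximum $1$, $\supset$ playing the role of the operation $a\backslash b$ = relative complement of $a$ in $[a\land b,1]$). A bilattice is an algebra $\langle B,\land,\lor,\otimes,\oplus,\neg\rangle$ such that $\langle B,\land,\lor\rangle$ and $\langle B,\otimes,\oplus\rangle$ are lattices (not necessarily bounded) with orders $\leq_t$ and $\leq_k$, and $\neg$ is unary with: $a\leq_t b\Rightarrow\neg b\leq_t\neg a$; $a\leq_k b\Rightarrow\neg a\leq_k\neg b$; $\neg\neg a=a$. An implicative bilattice is an algebra $\langle B,\land,\lor,\otimes,\oplus,\supset,\neg\rangle$ whose $\supset$-free reduct is a bilattice and which satisfies: (IB1) $(x\supset x)\supset y\approx y$; (IB2) $x\supset(y\supset z)\approx(x\land y)\supset z\approx(x\otimes y)\supset z$; (IB3) $((x\supset y)\supset x)\supset x\approx x\supset x$; (IB4) $(x\lor y)\supset z\approx(x\supset z)\land(y\supset z)\approx(x\oplus y)\supset z$; (IB5) $x\land((x\supset y)\supset(x\otimes y))\approx x$; (IB6) $\neg(x\supset y)\supset z\approx(x\land\neg y)\supset z$. For a classical implicative lattice $\mathbf L=\langle L,\sqcap,\sqcup,\backslash\rangle$, $\langle\mathbf L\odot\mathbf L,\supset\rangle$ is the implicative bilattice with universe $L\times L$ and operations $\langle a_1,a_2\rangle\land\langle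 b_1,b_2\rangle=\langle a_1\sqcap b_1,a_2\sqcup b_2\rangle$, $\langle a_1,a_2\rangle\lor\langle b_1,b_2\rangle=\langle a_1\sqcup b_1,a_2\sqcap b_2\rangle$, $\langle a_1,a_2\rangle\otimes\langle b_1,b_2\rangle=\langle a_1\sqcap b_1,a_2\sqcap b_2\rangle$, $\langle a_1,a_2\rangle\oplus\langle b_1,b_2\rangle=\langle a_1\sqcup b_1,a_2\sqcup b_2\rangle$, $\neg\langle a_1,a_2\rangle=\langle a_2,a_1\rangle$, $\langle a_1,a_2\rangle\supset\langle b_1,b_2\rangle=\langle a_1\backslash b_1,a_1\sqcap b_2\rangle$. A homomorphism (resp. embedding) from an $I$-algebra to an implicative bilattice is a map (resp. injective map) preserving $\supset$ and $\neg$; homomorphisms between implicative bilattices preserve all operations. *)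

theory Defs
  imports Main "HOL-Algebra.Congruence"
begin

subsection \<open>Signatures\<close>

record 'a imp_neg = "'a partial_object" +
  imp :: "'a \<Rightarrow> 'a \<Rightarrow> 'a" (infixr \<open>\<^bold>\<supset>\<index>\<close> 60)
  neg :: "'a \<Rightarrow> 'a" (\<open>\<^bold>\<not>\<index> _\<close> [81] 80)

text \<open>The bilattice signature extends the one above, so that a homomorphism of
  \<open>{\<supset>, \<not>}\<close>-algebras may have an implicative bilattice as its target.\<close>

record 'a bilat = "'a imp_neg" +
  tmeet :: "'a \<Rightarrow> 'a \<Rightarrow> 'a" (infixl \<open>\<^bold>\<and>\<index>\<close> 70)
  tjoin :: "'a \<Rightarrow> 'a \<Rightarrow> 'a" (infixl \<open>\<^bold>\<or>\<index>\<close> 65)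
  kmeet :: "'a \<Rightarrow> 'a \<Rightarrow> 'a" (infixl \<open>\<^bold>\<otimes>\<index>\<close> 70)
  kjoin :: "'a \<Rightarrow> 'a \<Rightarrow> 'a" (infixl \<open>\<^bold>\<oplus>\<index>\<close> 65)

record 'a imp_lattice = "'a partial_object" +
  lmeet :: "'a \<Rightarrow> 'a \<Rightarrow> 'a" (infixl \<open>\<^bold>\<sqinter>\<index>\<close> 70)
  ljoin :: "'a \<Rightarrow> 'a \<Rightarrow> 'a" (infixl \<open>\<^bold>\<squnion>\<index>\<close> 65)
  lres  :: "'a \<Rightarrow> 'a \<Rightarrow> 'a" (infixr \<open>\<^bold>\<setminus>\<index>\<close> 60)

definition lattice_on :: "'a set \<Rightarrow> ('a \<Rightarrow> 'a \<Rightarrow> 'a) \<Rightarrow> ('a \<Rightarrow> 'a \<Rightarrow> 'a) \<Rightarrow> bool" where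
  "lattice_on S m j \<longleftrightarrow> S \<noteq> {} \<and>
     (\<forall>x\<in>S. \<forall>y\<in>S. m x y \<in> S \<and> j x y \<in> S) \<and>
     (\<forall>x\<in>S. \<forall>y\<in>S. m x y = m y x \<and> j x y = j y x) \<and>
     (\<forall>x\<in>S. \<forall>y\<in>S. \<forall>z\<in>S. m (m x y) z = m x (m y z) \<and> j (j x y) z = j x (j y z)) \<and>
     (\<forall>x\<in>S. \<forall>y\<in>S. m x (j x y) = x \<and> j x (m x y) = x)"

subsection \<open>Classical implicative lattices\<close>

locale classical_implicative_lattice =
  fixes L :: "('a, 'm) imp_lattice_scheme" (structure)
  assumes lattice: "lattice_on (carrier L) (lmeet L) (ljoin L)"
    and res_closed: "\<lbrakk>x \<in> carrier L; y \<in> carrier L\<rbrakk> \<Longrightarrow> x \<^bold>\<setminus> y \<in> carrier L"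
    and distrib: "\<lbrakk>x \<in> carrier L; y \<in> carrier L; z \<in> carrier L\<rbrakk>
      \<Longrightarrow> x \<^bold>\<sqinter> (y \<^bold>\<squnion> z) = (x \<^bold>\<sqinter> y) \<^bold>\<squnion> (x \<^bold>\<sqinter> z)"
    and rel_compl: "\<lbrakk>x \<in> carrier L; y \<in> carrier L; z \<in> carrier L; x \<^bold>\<sqinter> y = x; y \<^bold>\<sqinter> z = y\<rbrakk>
      \<Longrightarrow> \<exists>w\<in>carrier L. y \<^bold>\<sqinter> w = x \<and> y \<^bold>\<squnion> w = z"
    and top_res: "\<exists>u\<in>carrier L. (\<forall>x\<in>carrier L. x \<^bold>\<sqinter> u = x) \<and>
      (\<forall>x\<in>carrier L. \<forall>y\<in>carrier L. x \<^bold>\<sqinter> (x \<^bold>\<setminus> y) = x \<^bold>\<sqinter> y \<and> x \<^bold>\<squnion> (x \<^bold>\<setminus> y) = u)"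

subsection \<open>Bilattices and implicative bilattices\<close>

locale bilattice =
  fixes B :: "('a, 'm) bilat_scheme" (structure)
  assumes truth_lattice: "lattice_on (carrier B) (tmeet B) (tjoin B)"
    and knowledge_lattice: "lattice_on (carrier B) (kmeet B) (kjoin B)"
    and neg_closed: "x \<in> carrier B \<Longrightarrow> \<^bold>\<not> x \<in> carrier B"
    and neg_truth: "\<lbrakk>x \<in> carrier B; y \<in> carrier B; x \<^bold>\<and> y = x\<rbrakk> \<Longrightarrow> \<^bold>\<not> y \<^bold>\<and> \<^bold>\<not> x = \<^bold>\<not> y"
    and neg_knowledge: "\<lbrakk>x \<in> carrier B; y \<in> carrier B; x \<^bold>\<otimes> y = x\<rbrakk> \<Longrightarrow> \<^bold>\<not> x \<^bold>\<otimes> \<^bold>\<not> y = \<^bold>\<not> x"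
    and neg_neg: "x \<in> carrier B \<Longrightarrow> \<^bold>\<not> (\<^bold>\<not> x) = x"

locale implicative_bilattice = bilattice +
  assumes imp_closed: "\<lbrakk>x \<in> carrier B; y \<in> carrier B\<rbrakk> \<Longrightarrow> x \<^bold>\<supset> y \<in> carrier B"
    and IB1: "\<lbrakk>x \<in> carrier B; y \<in> carrier B\<rbrakk> \<Longrightarrow> (x \<^bold>\<supset> x) \<^bold>\<supset> y = y"
    and IB2: "\<lbrakk>x \<in> carrier B; y \<in> carrier B; z \<in> carrier B\<rbrakk> \<Longrightarrow>
      x \<^bold>\<supset> (y \<^bold>\<supset> z) = (x \<^bold>\<and> y) \<^bold>\<supset> z \<and> (x \<^bold>\<and> y) \<^bold>\<supset> z = (x \<^bold>\<otimes> y) \<^bold>\<supset> z"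
    and IB3: "\<lbrakk>x \<in> carrier B; y \<in> carrier B\<rbrakk> \<Longrightarrow> ((x \<^bold>\<supset> y) \<^bold>\<supset> x) \<^bold>\<supset> x = x \<^bold>\<supset> x"
    and IB4: "\<lbrakk>x \<in> carrier B; y \<in> carrier B; z \<in> carrier B\<rbrakk> \<Longrightarrow>
      (x \<^bold>\<or> y) \<^bold>\<supset> z = (x \<^bold>\<supset> z) \<^bold>\<and> (y \<^bold>\<supset> z) \<and> (x \<^bold>\<supset> z) \<^bold>\<and> (y \<^bold>\<supset> z) = (x \<^bold>\<oplus> y) \<^bold>\<supset> z"
    and IB5: "\<lbrakk>x \<in> carrier B; y \<in> carrier B\<rbrakk> \<Longrightarrow> x \<^bold>\<and> ((x \<^bold>\<supset> y) \<^bold>\<supset> (x \<^bold>\<otimes> y)) = x"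
    and IB6: "\<lbrakk>x \<in> carrier B; y \<in> carrier B; z \<in> carrier B\<rbrakk> \<Longrightarrow>
      \<^bold>\<not> (x \<^bold>\<supset> y) \<^bold>\<supset> z = (x \<^bold>\<and> \<^bold>\<not> y) \<^bold>\<supset> z"

definition odot :: "('a, 'm) imp_lattice_scheme \<Rightarrow> ('a \<times> 'a) bilat" where
  "odot L =
    \<lparr>carrier = carrier L \<times> carrier L,
     imp = (\<lambda>(a1, a2) (b1, b2). (a1 \<^bold>\<setminus>\<^bsub>L\<^esub> b1, a1 \<^bold>\<sqinter>\<^bsub>L\<^esub> b2)),
     neg = (\<lambda>(a1, a2). (a2, a1)),
     tmeet = (\<lambda>(a1, a2) (b1, b2). (a1 \<^bold>\<sqinter>\<^bsub>L\<^esub> b1, a2 \<^bold>\<squnion>\<^bsub>L\<^esub> b2)),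
     tjoin = (\<lambda>(a1, a2) (b1, b2). (a1 \<^bold>\<squnion>\<^bsub>L\<^esub> b1, a2 \<^bold>\<sqinter>\<^bsub>L\<^esub> b2)),
     kmeet = (\<lambda>(a1, a2) (b1, b2). (a1 \<^bold>\<sqinter>\<^bsub>L\<^esub> b1, a2 \<^bold>\<sqinter>\<^bsub>L\<^esub> b2)),
     kjoin = (\<lambda>(a1, a2) (b1, b2). (a1 \<^bold>\<squnion>\<^bsub>L\<^esub> b1, a2 \<^bold>\<squnion>\<^bsub>L\<^esub> b2))\<rparr>"

subsection \<open>Homomorphisms and generated subalgebras\<close>

definition imp_neg_hom ::
    "('a, 'm) imp_neg_scheme \<Rightarrow> ('b, 'n) imp_neg_scheme \<Rightarrow> ('a \<Rightarrow> 'b) set" where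
  "imp_neg_hom A B = {h \<in> carrier A \<rightarrow> carrier B.
     (\<forall>x\<in>carrier A. \<forall>y\<in>carrier A. h (x \<^bold>\<supset>\<^bsub>A\<^esub> y) = h x \<^bold>\<supset>\<^bsub>B\<^esub> h y) \<and>
     (\<forall>x\<in>carrier A. h (\<^bold>\<not>\<^bsub>A\<^esub> x) = \<^bold>\<not>\<^bsub>B\<^esub> h x)}"

definition bilat_hom ::
    "('a, 'm) bilat_scheme \<Rightarrow> ('b, 'n) bilat_scheme \<Rightarrow> ('a \<Rightarrow> 'b) set" where
  "bilat_hom B C = {h \<in> imp_neg_hom B C. \<forall>x\<in>carrier B. \<forall>y\<in>carrier B.
     h (x \<^bold>\<and>\<^bsub>B\<^esub> y) = h x \<^bold>\<and>\<^bsub>C\<^esub> h y \<and> h (x \<^bold>\<or>\<^bsub>B\<^esub> y) = h x \<^bold>\<or>\<^bsub>C\<^esub> h y \<and>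
     h (x \<^bold>\<otimes>\<^bsub>B\<^esub> y) = h x \<^bold>\<otimes>\<^bsub>C\<^esub> h y \<and> h (x \<^bold>\<oplus>\<^bsub>B\<^esub> y) = h x \<^bold>\<oplus>\<^bsub>C\<^esub> h y}"

inductive_set generated :: "('a, 'm) bilat_scheme \<Rightarrow> 'a set \<Rightarrow> 'a set"
  for B (structure) and X where
  incl: "x \<in> X \<Longrightarrow> x \<in> generated B X"
| imp: "\<lbrakk>x \<in> generated B X; y \<in> generated B X\<rbrakk> \<Longrightarrow> x \<^bold>\<supset> y \<in> generated B X"
| neg: "x \<in> generated B X \<Longrightarrow> \<^bold>\<not> x \<in> generated B X"
| tmeet: "\<lbrakk>x \<in> generated B X; y \<in> generated B X\<rbrakk> \<Longrightarrow> x \<^bold>\<and> y \<in> generated B X"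
| tjoin: "\<lbrakk>x \<in> generated B X; y \<in> generated B X\<rbrakk> \<Longrightarrow> x \<^bold>\<or> y \<in> generated B X"
| kmeet: "\<lbrakk>x \<in> generated B X; y \<in> generated B X\<rbrakk> \<Longrightarrow> x \<^bold>\<otimes> y \<in> generated B X"
| kjoin: "\<lbrakk>x \<in> generated B X; y \<in> generated B X\<rbrakk> \<Longrightarrow> x \<^bold>\<oplus> y \<in> generated B X"

subsection \<open>I-algebras and their quotient\<close>

definition p_term :: "('a, 'm) imp_neg_scheme \<Rightarrow> 'a \<Rightarrow> 'a \<Rightarrow> 'a \<Rightarrow> 'a" where
  "p_term A x y z = (x \<^bold>\<supset>\<^bsub>A\<^esub> y) \<^bold>\<supset>\<^bsub>A\<^esub> (y \<^bold>\<supset>\<^bsub>A\<^esub> x) \<^bold>\<supset>\<^bsub>A\<^esub>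
     (\<^bold>\<not>\<^bsub>A\<^esub> x \<^bold>\<supset>\<^bsub>A\<^esub> \<^bold>\<not>\<^bsub>A\<^esub> y) \<^bold>\<supset>\<^bsub>A\<^esub> (\<^bold>\<not>\<^bsub>A\<^esub> y \<^bold>\<supset>\<^bsub>A\<^esub> \<^bold>\<not>\<^bsub>A\<^esub> x) \<^bold>\<supset>\<^bsub>A\<^esub> z"

locale i_algebra =
  fixes A :: "('a, 'm) imp_neg_scheme" (structure)
  assumes nonempty: "carrier A \<noteq> {}"
    and imp_closed: "\<lbrakk>x \<in> carrier A; y \<in> carrier A\<rbrakk> \<Longrightarrow> x \<^bold>\<supset> y \<in> carrier A"
    and neg_closed: "x \<in> carrier A \<Longrightarrow> \<^bold>\<not> x \<in> carrier A"
    and I1: "\<lbrakk>x \<in> carrier A; y \<in> carrier A\<rbrakk> \<Longrightarrow> (x \<^bold>\<supset> x) \<^bold>\<supset> y = y"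
    and I2: "\<lbrakk>x \<in> carrier A; y \<in> carrier A; z \<in> carrier A\<rbrakk> \<Longrightarrow>
      x \<^bold>\<supset> (y \<^bold>\<supset> z) = (x \<^bold>\<supset> y) \<^bold>\<supset> (x \<^bold>\<supset> z) \<and> (x \<^bold>\<supset> y) \<^bold>\<supset> (x \<^bold>\<supset> z) = y \<^bold>\<supset> (x \<^bold>\<supset> z)"
    and I3: "\<lbrakk>x \<in> carrier A; y \<in> carrier A\<rbrakk> \<Longrightarrow> ((x \<^bold>\<supset> y) \<^bold>\<supset> x) \<^bold>\<supset> x = x \<^bold>\<supset> x"
    and I4: "\<lbrakk>x \<in> carrier A; y \<in> carrier A; z \<in> carrier A\<rbrakk> \<Longrightarrow>
      x \<^bold>\<supset> (\<^bold>\<not> y \<^bold>\<supset> z) = \<^bold>\<not> (x \<^bold>\<supset> y) \<^bold>\<supset> z"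
    and I5: "x \<in> carrier A \<Longrightarrow> \<^bold>\<not> (\<^bold>\<not> x) = x"
    and I6: "\<lbrakk>x \<in> carrier A; y \<in> carrier A\<rbrakk> \<Longrightarrow> p_term A x y x = p_term A x y y"

definition sim :: "('a, 'm) imp_neg_scheme \<Rightarrow> ('a \<times> 'a) set" where
  "sim A = {(a, b). a \<in> carrier A \<and> b \<in> carrier A \<and>
     a \<^bold>\<supset>\<^bsub>A\<^esub> b = (a \<^bold>\<supset>\<^bsub>A\<^esub> b) \<^bold>\<supset>\<^bsub>A\<^esub> (a \<^bold>\<supset>\<^bsub>A\<^esub> b) \<and>
     b \<^bold>\<supset>\<^bsub>A\<^esub> a = (b \<^bold>\<supset>\<^bsub>A\<^esub> a) \<^bold>\<supset>\<^bsub>A\<^esub> (b \<^bold>\<supset>\<^bsub>A\<^esub> a)}"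

definition cls :: "('a, 'm) imp_neg_scheme \<Rightarrow> 'a \<Rightarrow> 'a set" where
  "cls A a = sim A `` {a}"

text \<open>Operations on classes are unions over all representatives.  All classes in such a union
  coincide, as shown by \<open>quot_imp_cls\<close> and \<open>quot_meet_cls\<close> below.\<close>

definition quot_imp :: "('a, 'm) imp_neg_scheme \<Rightarrow> 'a set \<Rightarrow> 'a set \<Rightarrow> 'a set" where
  "quot_imp A X Y = (\<Union>a\<in>X. \<Union>b\<in>Y. cls A (a \<^bold>\<supset>\<^bsub>A\<^esub> b))"

definition quot_meet :: "('a, 'm) imp_neg_scheme \<Rightarrow> 'a set \<Rightarrow> 'a set \<Rightarrow> 'a set" where
  "quot_meet A X Y = (\<Union>a\<in>X. \<Union>b\<in>Y. cls A (\<^bold>\<not>\<^bsub>A\<^esub> (a \<^bold>\<supset>\<^bsub>A\<^esub> \<^bold>\<not>\<^bsub>A\<^esub> b)))"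

definition quot :: "('a, 'm) imp_neg_scheme \<Rightarrow> 'a set imp_lattice" where
  "quot A =
    \<lparr>carrier = carrier A // sim A,
     lmeet = quot_meet A,
     ljoin = (\<lambda>X Y. quot_imp A (quot_imp A X Y) Y),
     lres = quot_imp A\<rparr>"

definition canon :: "('a, 'm) imp_neg_scheme \<Rightarrow> 'a \<Rightarrow> 'a set \<times> 'a set" where
  "canon A a = (cls A a, cls A (\<^bold>\<not>\<^bsub>A\<^esub> a))"

subsection \<open>The quotient is a classical implicative lattice\<close>

context i_algebra
begin

definition valid :: "'a \<Rightarrow> bool" where
  "valid e \<longleftrightarrow> e \<^bold>\<supset> e = e"

definition le :: "'a \<Rightarrow> 'a \<Rightarrow> bool" where
  "le a b \<longleftrightarrow> valid (a \<^bold>\<supset> b)"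

definition conj :: "'a \<Rightarrow> 'a \<Rightarrow> 'a" where
  "conj a b = \<^bold>\<not> (a \<^bold>\<supset> \<^bold>\<not> b)"

definition disj :: "'a \<Rightarrow> 'a \<Rightarrow> 'a" where
  "disj a b = (a \<^bold>\<supset> b) \<^bold>\<supset> b"

lemma conj_disj_closed: "\<lbrakk>a \<in> carrier A; b \<in> carrier A\<rbrakk> \<Longrightarrow> conj a b \<in> carrier A \<and> disj a b \<in> carrier A"
  by (simp add: conj_def disj_def imp_closed neg_closed)

lemma conj_imp: "\<lbrakk>a \<in> carrier A; b \<in> carrier A; c \<in> carrier A\<rbrakk> \<Longrightarrow> conj a b \<^bold>\<supset> c = a \<^bold>\<supset> b \<^bold>\<supset> c"
  unfolding conj_def using I4[of a "\<^bold>\<not> b" c] I5[of b] neg_closed by simp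

lemma I2a: "\<lbrakk>a \<in> carrier A; b \<in> carrier A; c \<in> carrier A\<rbrakk> \<Longrightarrow> (a \<^bold>\<supset> b) \<^bold>\<supset> (a \<^bold>\<supset> c) = a \<^bold>\<supset> (b \<^bold>\<supset> c)"
  using I2[of a b c] by simp

lemma I2b: "\<lbrakk>a \<in> carrier A; b \<in> carrier A; c \<in> carrier A\<rbrakk> \<Longrightarrow> a \<^bold>\<supset> (b \<^bold>\<supset> c) = b \<^bold>\<supset> (a \<^bold>\<supset> c)"
  using I2[of a b c] by simp

lemma valid_imp: "\<lbrakk>e \<in> carrier A; c \<in> carrier A; valid e\<rbrakk> \<Longrightarrow> e \<^bold>\<supset> c = c"
  unfolding valid_def using I1[of e c] by simp

lemma valid_self: "\<lbrakk>a \<in> carrier A\<rbrakk> \<Longrightarrow> valid (a \<^bold>\<supset> a)"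
  unfolding valid_def using I1[of a "a \<^bold>\<supset> a"] imp_closed by simp

lemma le_refl: "a \<in> carrier A \<Longrightarrow> le a a"
  by (simp add: le_def valid_self)

lemma valid_weaken: "\<lbrakk>a \<in> carrier A; e \<in> carrier A; valid e\<rbrakk> \<Longrightarrow> valid (a \<^bold>\<supset> e)"
  unfolding valid_def using I2a[of a e e] by simp

lemma le_trans: "\<lbrakk>a \<in> carrier A; b \<in> carrier A; c \<in> carrier A; le a b; le b c\<rbrakk> \<Longrightarrow> le a c"
  unfolding le_def using I2a[of a b c] valid_imp[of "a \<^bold>\<supset> b" "a \<^bold>\<supset> c"] valid_weaken[of a "b \<^bold>\<supset> c"] imp_closed by simp

lemma le_conj_adj: "\<lbrakk>a \<in> carrier A; b \<in> carrier A; c \<in> carrier A\<rbrakk> \<Longrightarrow> le (conj a b) c = le a (b \<^bold>\<supset> c)"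
  unfolding le_def using conj_imp by simp

lemma conj_le1: "\<lbrakk>a \<in> carrier A; b \<in> carrier A\<rbrakk> \<Longrightarrow> le (conj a b) a"
  unfolding le_def using I2b[of a b a] valid_weaken[of b "a \<^bold>\<supset> a"] valid_self[of a] imp_closed conj_imp by simp

lemma conj_le2: "\<lbrakk>a \<in> carrier A; b \<in> carrier A\<rbrakk> \<Longrightarrow> le (conj a b) b"
  unfolding le_def using valid_weaken[of a "b \<^bold>\<supset> b"] valid_self[of b] imp_closed conj_imp by simp

lemma le_imp: "\<lbrakk>a \<in> carrier A; b \<in> carrier A\<rbrakk> \<Longrightarrow> le b (a \<^bold>\<supset> b)"
  unfolding le_def using I2b[of b a b] valid_self valid_weaken imp_closed by simp

lemma le_cut: "\<lbrakk>a \<in> carrier A; b \<in> carrier A; c \<in> carrier A; le c a; le c (a \<^bold>\<supset> b)\<rbrakk> \<Longrightarrow> le c b"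
  unfolding le_def using I2a[of c a b] valid_imp[of "c \<^bold>\<supset> a" "c \<^bold>\<supset> b"] imp_closed by simp

lemma le_imp_conj: "\<lbrakk>a \<in> carrier A; b \<in> carrier A\<rbrakk> \<Longrightarrow> le a (b \<^bold>\<supset> conj a b)"
  using le_conj_adj[of a b "conj a b"] le_refl conj_disj_closed by simp

lemma le_conj: "\<lbrakk>a \<in> carrier A; b \<in> carrier A; c \<in> carrier A; le c a; le c b\<rbrakk> \<Longrightarrow> le c (conj a b)"
  using le_cut[of b "conj a b" c] le_trans[of c a "b \<^bold>\<supset> conj a b"] le_imp_conj conj_disj_closed imp_closed by simp

lemma le_disj1: "\<lbrakk>a \<in> carrier A; b \<in> carrier A\<rbrakk> \<Longrightarrow> le a (disj a b)"
  unfolding le_def disj_def using I2b[of a "a \<^bold>\<supset> b" b] valid_self imp_closed by simp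

lemma le_disj2: "\<lbrakk>a \<in> carrier A; b \<in> carrier A\<rbrakk> \<Longrightarrow> le b (disj a b)"
  unfolding disj_def using le_imp imp_closed by simp

lemma imp_mono: "\<lbrakk>a \<in> carrier A; b \<in> carrier A; c \<in> carrier A; le a b\<rbrakk> \<Longrightarrow> le (c \<^bold>\<supset> a) (c \<^bold>\<supset> b)"
  unfolding le_def using I2a valid_weaken imp_closed by simp

lemma imp_anti: "\<lbrakk>a \<in> carrier A; b \<in> carrier A; c \<in> carrier A; le a b\<rbrakk> \<Longrightarrow> le (b \<^bold>\<supset> c) (a \<^bold>\<supset> c)"
  using le_trans[of a b "disj b c"] le_disj1[of b c] I2b[of a "b \<^bold>\<supset> c" c] conj_disj_closed imp_closed unfolding le_def disj_def by simp

lemma disj_le: "\<lbrakk>a \<in> carrier A; b \<in> carrier A; c \<in> carrier A; le a c; le b c\<rbrakk> \<Longrightarrow> le (disj a b) c"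
proof -
  assume a: "a \<in> carrier A" "b \<in> carrier A" "c \<in> carrier A" "le a c" "le b c"
  have 1: "le (disj a b) ((a \<^bold>\<supset> b) \<^bold>\<supset> c)" using imp_mono a imp_closed disj_def by simp
  have "le (c \<^bold>\<supset> b) (a \<^bold>\<supset> b)" using imp_anti a by simp
  then have "le ((a \<^bold>\<supset> b) \<^bold>\<supset> c) ((c \<^bold>\<supset> b) \<^bold>\<supset> c)" using imp_anti a imp_closed by simp
  moreover have "le ((c \<^bold>\<supset> b) \<^bold>\<supset> c) c" unfolding le_def using I3[of c b] valid_self a imp_closed by simp
  ultimately have "le ((a \<^bold>\<supset> b) \<^bold>\<supset> c) c" using le_trans[of "(a \<^bold>\<supset> b) \<^bold>\<supset> c" "(c \<^bold>\<supset> b) \<^bold>\<supset> c" c] a imp_closed by simp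
  then show ?thesis using le_trans[OF _ _ _ 1] a conj_disj_closed imp_closed by simp
qed

lemma conj_le1': "\<lbrakk>a \<in> carrier A; b \<in> carrier A; c \<in> carrier A; le a c\<rbrakk> \<Longrightarrow> le (conj a b) c"
  using le_trans[OF _ _ _ conj_le1] conj_disj_closed by blast

lemma conj_le2': "\<lbrakk>a \<in> carrier A; b \<in> carrier A; c \<in> carrier A; le b c\<rbrakk> \<Longrightarrow> le (conj a b) c"
  using le_trans[OF _ _ _ conj_le2] conj_disj_closed by blast

lemma le_disj1': "\<lbrakk>a \<in> carrier A; b \<in> carrier A; c \<in> carrier A; le c a\<rbrakk> \<Longrightarrow> le c (disj a b)"
  using le_trans[OF _ _ _ _ le_disj1] conj_disj_closed by blast

lemma le_disj2': "\<lbrakk>a \<in> carrier A; b \<in> carrier A; c \<in> carrier A; le c b\<rbrakk> \<Longrightarrow> le c (disj a b)"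
  using le_trans[OF _ _ _ _ le_disj2] conj_disj_closed by blast

lemma conj_closed: "\<lbrakk>a \<in> carrier A; b \<in> carrier A\<rbrakk> \<Longrightarrow> conj a b \<in> carrier A" and disj_closed: "\<lbrakk>a \<in> carrier A; b \<in> carrier A\<rbrakk> \<Longrightarrow> disj a b \<in> carrier A"
  using conj_disj_closed by auto

lemmas le_intros = conj_le1' conj_le2' le_conj le_disj1' le_disj2' disj_le le_refl conj_closed disj_closed imp_closed

lemma sim_iff: "(a,b) \<in> sim A \<longleftrightarrow> a \<in> carrier A \<and> b \<in> carrier A \<and> le a b \<and> le b a"
  unfolding sim_def le_def valid_def by auto

lemma equiv_sim: "equiv (carrier A) (sim A)"
  apply (rule equivI)
  apply (auto simp: sim_iff refl_on_def sym_def trans_def le_refl intro: le_trans)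
   done

lemma imp_cong_sim: "\<lbrakk>(a,a') \<in> sim A; (b,b') \<in> sim A\<rbrakk> \<Longrightarrow> (a \<^bold>\<supset> b, a' \<^bold>\<supset> b') \<in> sim A"
  unfolding sim_iff
  using le_trans[of "a \<^bold>\<supset> b" "a \<^bold>\<supset> b'" "a' \<^bold>\<supset> b'"] le_trans[of "a' \<^bold>\<supset> b'" "a \<^bold>\<supset> b'" "a \<^bold>\<supset> b"]
   by (simp add: imp_anti imp_mono imp_closed)

lemma conj_cong_sim: "\<lbrakk>(a,a') \<in> sim A; (b,b') \<in> sim A\<rbrakk> \<Longrightarrow> (conj a b, conj a' b') \<in> sim A"
  unfolding sim_iff by (auto intro!: le_conj conj_closed intro: conj_le1' conj_le2')

lemma UN_cls: "\<lbrakk>a \<in> carrier A; b \<in> carrier A; \<And>a' b'. \<lbrakk>(a,a') \<in> sim A; (b,b') \<in> sim A\<rbrakk> \<Longrightarrow> (g a b, g a' b') \<in> sim A\<rbrakk> \<Longrightarrow>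
  (\<Union>x\<in>cls A a. \<Union>y\<in>cls A b. cls A (g x y)) = cls A (g a b)"
proof -
  assume a: "a \<in> carrier A" "b \<in> carrier A" and g: "\<And>a' b'. \<lbrakk>(a,a') \<in> sim A; (b,b') \<in> sim A\<rbrakk> \<Longrightarrow> (g a b, g a' b') \<in> sim A"
  have "cls A (g x y) = cls A (g a b)" if "x \<in> cls A a" "y \<in> cls A b" for x y
    using that g unfolding cls_def by (metis Image_singleton_iff equiv_sim equiv_class_eq)
  moreover have "a \<in> cls A a" "b \<in> cls A b" using a by (auto simp: cls_def sim_iff le_refl)
  ultimately show ?thesis by blast
qed

lemma quot_imp_cls: "\<lbrakk>a \<in> carrier A; b \<in> carrier A\<rbrakk> \<Longrightarrow> quot_imp A (cls A a) (cls A b) = cls A (a \<^bold>\<supset> b)"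
  unfolding quot_imp_def by (rule UN_cls) (auto intro: imp_cong_sim)

lemma quot_meet_cls: "\<lbrakk>a \<in> carrier A; b \<in> carrier A\<rbrakk> \<Longrightarrow> quot_meet A (cls A a) (cls A b) = cls A (\<^bold>\<not> (a \<^bold>\<supset> \<^bold>\<not> b))"
  using UN_cls[of a b "conj"] conj_cong_sim unfolding quot_meet_def by (simp add: conj_def)

lemma quot_join_cls: "\<lbrakk>a \<in> carrier A; b \<in> carrier A\<rbrakk> \<Longrightarrow> ljoin (quot A) (cls A a) (cls A b) = cls A (disj a b)"
  by (simp add: quot_def quot_imp_cls imp_closed disj_def)

lemma quot_ops: assumes "a \<in> carrier A" "b \<in> carrier A" shows "lmeet (quot A) (cls A a) (cls A b) = cls A (conj a b)"
  "ljoin (quot A) (cls A a) (cls A b) = cls A (disj a b)" "lres (quot A) (cls A a) (cls A b) = cls A (a \<^bold>\<supset> b)"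
  using assms quot_join_cls by (simp_all add: quot_def quot_imp_cls quot_meet_cls conj_def)

lemma quot_carrier: "carrier (quot A) = cls A ` carrier A"
  by (auto simp: quot_def cls_def quotient_def)

lemma cls_eq: "\<lbrakk>a \<in> carrier A; b \<in> carrier A\<rbrakk> \<Longrightarrow> cls A a = cls A b \<longleftrightarrow> le a b \<and> le b a"
  unfolding cls_def by (metis eq_equiv_class_iff equiv_sim sim_iff)

lemma le_meet: "\<lbrakk>a \<in> carrier A; b \<in> carrier A\<rbrakk> \<Longrightarrow> cls A (conj a b) = cls A a \<longleftrightarrow> le a b"
  apply (auto simp: cls_eq conj_closed intro: le_intros)
  using le_trans[OF _ _ _ _ conj_le2] conj_closed by blast

lemma le_conj_adj2: "\<lbrakk>a \<in> carrier A; b \<in> carrier A; c \<in> carrier A\<rbrakk> \<Longrightarrow> le (conj a b) c = le b (a \<^bold>\<supset> c)"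
  using le_conj_adj[of a b c] I2b[of a b c] unfolding le_def by simp

lemma conj_disj_le: assumes "a \<in> carrier A" "b \<in> carrier A" "c \<in> carrier A"
  shows "le (conj a (disj b c)) (disj (conj a b) (conj a c))"
proof -
  let ?d = "disj (conj a b) (conj a c)"
  have "le b (a \<^bold>\<supset> ?d)" "le c (a \<^bold>\<supset> ?d)"
    using assms le_conj_adj2[of a b ?d] le_conj_adj2[of a c ?d] le_disj1[of "conj a b" "conj a c"] le_disj2[of "conj a b" "conj a c"] conj_disj_closed by auto
  then have "le (disj b c) (a \<^bold>\<supset> ?d)" using disj_le assms conj_disj_closed imp_closed by simp
  then show ?thesis using assms conj_disj_closed le_conj_adj2 by simp
qed

lemma conj_mp: assumes "a \<in> carrier A" "b \<in> carrier A" shows "le (conj a (a \<^bold>\<supset> b)) b"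
  using assms le_conj_adj2[of a "a \<^bold>\<supset> b" b] le_refl imp_closed by simp

lemma res_meet: assumes "a \<in> carrier A" "b \<in> carrier A"
  shows "cls A (conj a (a \<^bold>\<supset> b)) = cls A (conj a b)"
  using assms conj_mp le_imp by (auto simp: cls_eq imp_closed conj_disj_closed intro!: le_conj intro: conj_le1 conj_le2')

lemma res_join: assumes "a \<in> carrier A" "b \<in> carrier A"
  shows "valid (disj a (a \<^bold>\<supset> b))"
  unfolding disj_def using assms I2a[of a a b] I1[of a] valid_self imp_closed by simp

lemma lattice_quot: "lattice_on (carrier (quot A)) (lmeet (quot A)) (ljoin (quot A))"
  unfolding lattice_on_def quot_carrier
  apply (intro conjI)
  subgoal using nonempty by simp
  apply (simp_all add: quot_ops conj_disj_closed cls_eq ball_simps)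
  subgoal by (blast intro: le_intros)
  subgoal by (blast intro: le_intros)
  subgoal by (blast intro: le_intros)
  done

lemma classical_implicative_lattice_quot: "classical_implicative_lattice (quot A)"
proof
  show "lattice_on (carrier (quot A)) (lmeet (quot A)) (ljoin (quot A))" by (rule lattice_quot)
  show "x \<^bold>\<setminus>\<^bsub>quot A\<^esub> y \<in> carrier (quot A)" if "x \<in> carrier (quot A)" "y \<in> carrier (quot A)" for x y
    using that by (auto simp: quot_carrier quot_ops imp_closed)
  show "x \<^bold>\<sqinter>\<^bsub>quot A\<^esub> (y \<^bold>\<squnion>\<^bsub>quot A\<^esub> z) = x \<^bold>\<sqinter>\<^bsub>quot A\<^esub> y \<^bold>\<squnion>\<^bsub>quot A\<^esub> x \<^bold>\<sqinter>\<^bsub>quot A\<^esub> z"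
    if H: "x \<in> carrier (quot A)" "y \<in> carrier (quot A)" "z \<in> carrier (quot A)" for x y z
  proof -
    obtain a b c where abc: "a \<in> carrier A" "b \<in> carrier A" "c \<in> carrier A"
      and "x = cls A a" "y = cls A b" "z = cls A c" using H by (auto simp: quot_carrier)
    moreover have "le (disj (conj a b) (conj a c)) (conj a (disj b c))"
      using abc by (blast intro: le_intros)
    ultimately show ?thesis by (simp add: quot_ops conj_disj_closed cls_eq conj_disj_le)
  qed
  show "\<exists>w\<in>carrier (quot A). y \<^bold>\<sqinter>\<^bsub>quot A\<^esub> w = x \<and> y \<^bold>\<squnion>\<^bsub>quot A\<^esub> w = z"
    if H: "x \<in> carrier (quot A)" "y \<in> carrier (quot A)" "z \<in> carrier (quot A)"
     "x \<^bold>\<sqinter>\<^bsub>quot A\<^esub> y = x" "y \<^bold>\<sqinter>\<^bsub>quot A\<^esub> z = y" for x y z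
  proof -
    obtain a b c where abc: "a \<in> carrier A" "b \<in> carrier A" "c \<in> carrier A"
      and e: "x = cls A a" "y = cls A b" "z = cls A c" using H by (auto simp: quot_carrier)
    with H have le: "le a b" "le b c" by (simp_all add: quot_ops le_meet)
    let ?w = "conj (b \<^bold>\<supset> a) c"
    have w: "?w \<in> carrier A" using abc conj_disj_closed imp_closed by simp
    have "le (conj b ?w) (conj b (b \<^bold>\<supset> a))" using abc w by (intro le_conj conj_le1 conj_le2' conj_le1' le_refl conj_closed imp_closed)
    moreover have "le (conj b (b \<^bold>\<supset> a)) a" using abc conj_mp by simp
    ultimately have 1: "le (conj b ?w) a" using abc w le_trans[of "conj b ?w" "conj b (b \<^bold>\<supset> a)" a] conj_disj_closed imp_closed by simp
    have "le a (b \<^bold>\<supset> a)" using abc le_imp by simp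
    then have 2: "le a (conj b ?w)" using abc w le le_trans[of a b c] by (auto intro!: le_conj imp_closed)
    have 3: "le (disj b ?w) c" using abc w le by (intro disj_le conj_le2 imp_closed)
    have v: "valid (disj b (b \<^bold>\<supset> a))" using res_join abc by simp
    then have "le c (disj b (b \<^bold>\<supset> a))" unfolding le_def using valid_weaken abc conj_disj_closed imp_closed by simp
    then have "le c (conj c (disj b (b \<^bold>\<supset> a)))" using abc by (intro le_conj le_refl disj_closed imp_closed)
    moreover have "le (conj c (disj b (b \<^bold>\<supset> a))) (disj (conj c b) (conj c (b \<^bold>\<supset> a)))" using abc conj_disj_le imp_closed by simp
    moreover have "le (conj c b) (disj b ?w)" using abc w by (intro le_disj1' conj_le2 conj_closed imp_closed)
    moreover have "le (conj c (b \<^bold>\<supset> a)) (disj b ?w)" using abc w by (intro le_disj2' le_conj conj_le2 conj_le1 conj_closed imp_closed)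
    ultimately have "le c (disj b ?w)" using abc w le_trans[of c "conj c (disj b (b \<^bold>\<supset> a))" "disj b ?w"] le_trans[of "conj c (disj b (b \<^bold>\<supset> a))" "disj (conj c b) (conj c (b \<^bold>\<supset> a))" "disj b ?w"] by (simp add: disj_le conj_disj_closed imp_closed)
    then show ?thesis using 1 2 3 abc w e
      by (intro bexI[of _ "cls A ?w"]) (auto simp: quot_ops cls_eq conj_disj_closed quot_carrier)
  qed
  show "\<exists>u\<in>carrier (quot A). (\<forall>x\<in>carrier (quot A). x \<^bold>\<sqinter>\<^bsub>quot A\<^esub> u = x) \<and>
      (\<forall>x\<in>carrier (quot A). \<forall>y\<in>carrier (quot A). x \<^bold>\<sqinter>\<^bsub>quot A\<^esub> (x \<^bold>\<setminus>\<^bsub>quot A\<^esub> y) = x \<^bold>\<sqinter>\<^bsub>quot A\<^esub> y \<and> x \<^bold>\<squnion>\<^bsub>quot A\<^esub> (x \<^bold>\<setminus>\<^bsub>quot A\<^esub> y) = u)"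
  proof -
    obtain e where e: "e \<in> carrier A" using nonempty by blast
    let ?u = "e \<^bold>\<supset> e"
    have u: "?u \<in> carrier A" "valid ?u" using e imp_closed valid_self by auto
    have uu: "cls A b = cls A ?u" if "b \<in> carrier A" "valid b" for b
      using that u cls_eq valid_weaken le_def by simp
    show ?thesis using u
      by (intro bexI[of _ "cls A ?u"])
         (auto simp: quot_carrier quot_ops imp_closed conj_disj_closed res_meet le_meet le_def valid_weaken intro!: uu res_join)
  qed
qed
end

end

theory Submission
  imports Defs
begin

text \<open>
  The main point is that the \<open>{\<supset>, \<not>}\<close>-reduct of an implicative bilattice \<open>B\<close> is an
  \<open>I\<close>-algebra.  Say that \<open>x\<close> entails \<open>y\<close> if \<open>x \<supset> y\<close> is designated (equal to its own
  implication by itself).  Axiom IB5 turns entailment into the inequality \<open>x \<le>\<^sub>t x \<otimes> y\<close>,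
  which gives the deduction laws of \<open>\<supset>\<close> and shows that mutually entailing elements with
  mutually entailing negations are equal.  All four lattice operations become meets and joins
  for the entailment preorder, so \<open>h : B \<rightarrow> B/\<sim> \<odot> B/\<sim>\<close> is an injective bilattice
  homomorphism; it is onto because \<open>h\<close> of an \<open>I\<close>-algebra always generates the target.  Hence a
  homomorphism \<open>f\<close> from \<open>A\<close> to \<open>B\<close>, which induces a map \<open>f/\<sim> : A/\<sim> \<rightarrow> B/\<sim>\<close>, extends
  as \<open>h\<inverse> \<circ> (f/\<sim> \<times> f/\<sim>)\<close>, and uniquely so because the image of \<open>A\<close> generates.
\<close>

section \<open>Lattices on a carrier set, with the order read off from meets\<close>

lemma lattice_on_dual: "lattice_on S m j \<longleftrightarrow> lattice_on S j m"
  unfolding lattice_on_def by blast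

lemma lattice_onD:
  assumes "lattice_on S m j"
  shows lattice_on_meet_closed: "\<lbrakk>x \<in> S; y \<in> S\<rbrakk> \<Longrightarrow> m x y \<in> S"
    and lattice_on_join_closed: "\<lbrakk>x \<in> S; y \<in> S\<rbrakk> \<Longrightarrow> j x y \<in> S"
    and lattice_on_meet_commute: "\<lbrakk>x \<in> S; y \<in> S\<rbrakk> \<Longrightarrow> m x y = m y x"
    and lattice_on_meet_assoc: "\<lbrakk>x \<in> S; y \<in> S; z \<in> S\<rbrakk> \<Longrightarrow> m (m x y) z = m x (m y z)"
  using assms unfolding lattice_on_def by blast+

lemma lattice_on_meet_idem:
  assumes "lattice_on S m j" "x \<in> S"
  shows "m x x = x"
  using assms unfolding lattice_on_def by metis

lemma lattice_on_meet_le: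
  assumes l: "lattice_on S m j" and S: "x \<in> S" "y \<in> S"
  shows "m (m x y) x = m x y" "m (m x y) y = m x y"
  using lattice_on_meet_assoc[OF l] lattice_on_meet_commute[OF l] lattice_on_meet_idem[OF l]
    lattice_on_meet_closed[OF l] S by metis+

lemma lattice_on_le_iff:
  assumes "lattice_on S m j" "x \<in> S" "y \<in> S"
  shows "m x y = x \<longleftrightarrow> j x y = y"
  using assms unfolding lattice_on_def by metis

lemma lattice_on_le_trans:
  assumes l: "lattice_on S m j" and S: "x \<in> S" "y \<in> S" "z \<in> S" and le: "m x y = x" "m y z = y"
  shows "m x z = x"
  using lattice_on_meet_assoc[OF l S] le by simp

lemma lattice_on_le_antisym:
  assumes l: "lattice_on S m j" and S: "x \<in> S" "y \<in> S" and le: "m x y = x" "m y x = y"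
  shows "x = y"
  using lattice_on_meet_commute[OF l S] le by simp

lemma lattice_on_le_meet:
  assumes l: "lattice_on S m j" and S: "x \<in> S" "y \<in> S" "z \<in> S" and le: "m z x = z" "m z y = z"
  shows "m z (m x y) = z"
  using lattice_on_meet_assoc[OF l, of z x y] S le by simp

lemma lattice_on_le_join:
  assumes l: "lattice_on S m j" and S: "x \<in> S" "y \<in> S"
  shows "m x (j x y) = x" "m y (j x y) = y"
  using l S unfolding lattice_on_def by metis+

lemma lattice_on_join_le:
  assumes l: "lattice_on S m j" and S: "x \<in> S" "y \<in> S" "z \<in> S" and le: "m x z = x" "m y z = y"
  shows "m (j x y) z = j x y"
proof -
  note d = l[unfolded lattice_on_dual[of S m]]
  have "j x z = z" "j y z = z"
    using le lattice_on_le_iff[OF l] S by auto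
  then have "j (j x y) z = z"
    using lattice_on_meet_assoc[OF d, of x y z] S by simp
  then show ?thesis
    using lattice_on_le_iff[OF l] lattice_on_join_closed[OF l] S by simp
qed

text \<open>An involution monotone in both directions is an order isomorphism, so it preserves
  greatest lower bounds. Source and target are kept separate so that pairing a lattice with its dual
  yields De Morgan laws.\<close>

lemma lattice_on_involution_meet:
  assumes l: "lattice_on S m j" and l': "lattice_on S m' j'"
    and closed: "\<And>x. x \<in> S \<Longrightarrow> n x \<in> S" and inv: "\<And>x. x \<in> S \<Longrightarrow> n (n x) = x"
    and mono: "\<And>x y. \<lbrakk>x \<in> S; y \<in> S; m x y = x\<rbrakk> \<Longrightarrow> m' (n x) (n y) = n x"
    and mono': "\<And>x y. \<lbrakk>x \<in> S; y \<in> S; m' x y = x\<rbrakk> \<Longrightarrow> m (n x) (n y) = n x"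
    and S: "x \<in> S" "y \<in> S"
  shows "n (m x y) = m' (n x) (n y)"
proof (rule lattice_on_le_antisym[OF l'])
  let ?b = "m' (n x) (n y)"
  have c: "m x y \<in> S" "n x \<in> S" "n y \<in> S" "?b \<in> S"
    using S closed lattice_on_meet_closed[OF l] lattice_on_meet_closed[OF l'] by auto
  show "n (m x y) \<in> S" "?b \<in> S"
    using c closed by auto
  show "m' (n (m x y)) ?b = n (m x y)"
    using c S closed by (intro lattice_on_le_meet[OF l'] mono lattice_on_meet_le[OF l]) auto
  have "m (n ?b) (m x y) = n ?b"
    using mono'[OF c(4) c(2) lattice_on_meet_le(1)[OF l' c(2,3)]]
      mono'[OF c(4) c(3) lattice_on_meet_le(2)[OF l' c(2,3)]] inv S c closed
    by (intro lattice_on_le_meet[OF l]) auto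
  then show "m' ?b (n (m x y)) = ?b"
    using mono[of "n ?b" "m x y"] c closed inv by simp
qed

section \<open>Classical implicative lattices and their product bilattice\<close>

context classical_implicative_lattice
begin

definition le :: "'a \<Rightarrow> 'a \<Rightarrow> bool" (infix \<open>\<preceq>\<close> 50) where
  "x \<preceq> y \<longleftrightarrow> x \<^bold>\<sqinter> y = x"

lemma meet_closed: "\<lbrakk>x \<in> carrier L; y \<in> carrier L\<rbrakk> \<Longrightarrow> x \<^bold>\<sqinter> y \<in> carrier L"
  and join_closed: "\<lbrakk>x \<in> carrier L; y \<in> carrier L\<rbrakk> \<Longrightarrow> x \<^bold>\<squnion> y \<in> carrier L"
  using lattice by (simp_all add: lattice_on_meet_closed lattice_on_join_closed)

lemmas closed = meet_closed join_closed res_closed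

lemmas meet_commute = lattice_on_meet_commute[OF lattice]
  and join_commute = lattice_on_meet_commute[OF lattice[unfolded lattice_on_dual[of _ "lmeet L"]]]
  and meet_assoc = lattice_on_meet_assoc[OF lattice]
  and meet_idem = lattice_on_meet_idem[OF lattice]
  and meet_le = lattice_on_meet_le[OF lattice, folded le_def]
  and le_meet = lattice_on_le_meet[OF lattice, folded le_def]
  and join_le = lattice_on_join_le[OF lattice, folded le_def]
  and le_join = lattice_on_le_join[OF lattice, folded le_def]
  and le_trans = lattice_on_le_trans[OF lattice, folded le_def]
  and le_antisym = lattice_on_le_antisym[OF lattice, folded le_def]
  and le_iff_join = lattice_on_le_iff[OF lattice, folded le_def]

lemma meet_res: "\<lbrakk>x \<in> carrier L; y \<in> carrier L\<rbrakk> \<Longrightarrow> x \<^bold>\<sqinter> (x \<^bold>\<setminus> y) = x \<^bold>\<sqinter> y"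
  using top_res by blast

text \<open>The top is given only by an existence axiom, so maximality of the join is expressed as
  lying above every \<open>z\<close>.\<close>

lemma le_join_res: "\<lbrakk>x \<in> carrier L; y \<in> carrier L; z \<in> carrier L\<rbrakk> \<Longrightarrow> z \<preceq> x \<^bold>\<squnion> (x \<^bold>\<setminus> y)"
  using top_res unfolding le_def by metis

text \<open>Residuation. From left to right, \<open>meet_res\<close> acts as modus ponens.
  Conversely, \<open>z\<close> splits by distributivity along \<open>x\<close> and
  \<open>x \<setminus> y\<close>, whose join is the top, and both parts lie below
  \<open>x \<setminus> y\<close>.\<close>

lemma le_res_iff:
  assumes c: "x \<in> carrier L" "y \<in> carrier L" "z \<in> carrier L"
  shows "z \<preceq> x \<^bold>\<setminus> y \<longleftrightarrow> x \<^bold>\<sqinter> z \<preceq> y"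
proof
  assume "z \<preceq> x \<^bold>\<setminus> y"
  then have "x \<^bold>\<sqinter> z = (x \<^bold>\<sqinter> (x \<^bold>\<setminus> y)) \<^bold>\<sqinter> z"
    unfolding le_def using c meet_assoc[of x "x \<^bold>\<setminus> y" z] meet_commute[of z "x \<^bold>\<setminus> y"] closed by simp
  then have "x \<^bold>\<sqinter> z = (x \<^bold>\<sqinter> z) \<^bold>\<sqinter> y"
    using c meet_res meet_assoc meet_commute by metis
  then show "x \<^bold>\<sqinter> z \<preceq> y" by (simp add: le_def)
next
  assume le: "x \<^bold>\<sqinter> z \<preceq> y"
  have "z = (z \<^bold>\<sqinter> x) \<^bold>\<squnion> (z \<^bold>\<sqinter> (x \<^bold>\<setminus> y))"
    using le_join_res[of x y z] distrib[of z x "x \<^bold>\<setminus> y"] c closed by (simp add: le_def)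
  moreover have "z \<^bold>\<sqinter> x \<preceq> x \<^bold>\<setminus> y"
  proof (rule le_trans[of _ "x \<^bold>\<sqinter> (x \<^bold>\<setminus> y)"])
    have "z \<^bold>\<sqinter> x \<preceq> x \<^bold>\<sqinter> y"
      using le c closed meet_commute[of z x] by (intro le_meet meet_le) auto
    then show "z \<^bold>\<sqinter> x \<preceq> x \<^bold>\<sqinter> (x \<^bold>\<setminus> y)"
      using meet_res c by simp
  qed (use c closed meet_le in auto)
  ultimately show "z \<preceq> x \<^bold>\<setminus> y"
    using c closed join_le[of "z \<^bold>\<sqinter> x" "z \<^bold>\<sqinter> (x \<^bold>\<setminus> y)" "x \<^bold>\<setminus> y"] meet_le by metis
qed

text \<open>Reduces equations about implications to a comparison of lower bounds, where
  \<open>le_res_iff\<close> moves the antecedents to the left.\<close>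

lemma eq_iff_le:
  assumes "x \<in> carrier L" "y \<in> carrier L" "\<And>z. z \<in> carrier L \<Longrightarrow> z \<preceq> x \<longleftrightarrow> z \<preceq> y"
  shows "x = y"
  using assms le_antisym meet_idem le_def by metis

lemma le_res_self: "\<lbrakk>x \<in> carrier L; z \<in> carrier L\<rbrakk> \<Longrightarrow> z \<preceq> x \<^bold>\<setminus> x"
  by (simp add: le_res_iff meet_le)

lemma res_self_meet: "\<lbrakk>x \<in> carrier L; y \<in> carrier L\<rbrakk> \<Longrightarrow> (x \<^bold>\<setminus> x) \<^bold>\<sqinter> y = y"
  using le_res_self meet_commute res_closed unfolding le_def by metis

lemma res_self_res: "\<lbrakk>x \<in> carrier L; y \<in> carrier L\<rbrakk> \<Longrightarrow> (x \<^bold>\<setminus> x) \<^bold>\<setminus> y = y"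
  by (rule eq_iff_le) (simp_all add: closed le_res_iff res_self_meet)

lemma res_res:
  assumes "x \<in> carrier L" "y \<in> carrier L" "z \<in> carrier L"
  shows "x \<^bold>\<setminus> (y \<^bold>\<setminus> z) = (x \<^bold>\<sqinter> y) \<^bold>\<setminus> z"
  using assms meet_commute[of x y] meet_assoc[of y x]
  by (intro eq_iff_le) (simp_all add: closed le_res_iff)

lemma join_meet_distrib:
  "\<lbrakk>x \<in> carrier L; y \<in> carrier L; z \<in> carrier L\<rbrakk>
    \<Longrightarrow> (x \<^bold>\<squnion> y) \<^bold>\<sqinter> z = (x \<^bold>\<sqinter> z) \<^bold>\<squnion> (y \<^bold>\<sqinter> z)"
  using distrib meet_commute closed by metis

lemma le_meet_iff:
  "\<lbrakk>x \<in> carrier L; y \<in> carrier L; z \<in> carrier L\<rbrakk> \<Longrightarrow> z \<preceq> x \<^bold>\<sqinter> y \<longleftrightarrow> z \<preceq> x \<and> z \<preceq> y"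
  using le_trans[of z "x \<^bold>\<sqinter> y"] meet_le le_meet meet_closed by metis

lemma join_le_iff:
  "\<lbrakk>x \<in> carrier L; y \<in> carrier L; z \<in> carrier L\<rbrakk> \<Longrightarrow> x \<^bold>\<squnion> y \<preceq> z \<longleftrightarrow> x \<preceq> z \<and> y \<preceq> z"
  using le_trans[of _ "x \<^bold>\<squnion> y" z] le_join join_le join_closed by metis

lemma join_res:
  assumes "x \<in> carrier L" "y \<in> carrier L" "z \<in> carrier L"
  shows "(x \<^bold>\<squnion> y) \<^bold>\<setminus> z = (x \<^bold>\<setminus> z) \<^bold>\<sqinter> (y \<^bold>\<setminus> z)"
  using assms
  by (intro eq_iff_le) (simp_all add: closed le_res_iff le_meet_iff join_le_iff join_meet_distrib)

text \<open>A strong form of Peirce's law. For \<open>z\<close> below the left side, the part of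
  \<open>z\<close> in \<open>x \<setminus> y\<close> lies below \<open>x\<close> by residuation and
  the part in \<open>x\<close> trivially; the two parts join to \<open>z\<close>.\<close>

lemma res_res_self:
  assumes c: "x \<in> carrier L" "y \<in> carrier L"
  shows "(x \<^bold>\<setminus> y) \<^bold>\<setminus> x = x"
proof (rule eq_iff_le)
  fix z assume z: "z \<in> carrier L"
  show "z \<preceq> (x \<^bold>\<setminus> y) \<^bold>\<setminus> x \<longleftrightarrow> z \<preceq> x"
  proof
    assume "z \<preceq> (x \<^bold>\<setminus> y) \<^bold>\<setminus> x"
    then have "(x \<^bold>\<setminus> y) \<^bold>\<sqinter> z \<preceq> x" using c z by (simp add: closed le_res_iff)
    moreover have "x \<^bold>\<sqinter> z \<preceq> x" using c z by (simp add: meet_le)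
    ultimately have "(x \<^bold>\<squnion> (x \<^bold>\<setminus> y)) \<^bold>\<sqinter> z \<preceq> x"
      using c z by (simp add: join_meet_distrib join_le closed)
    moreover have "(x \<^bold>\<squnion> (x \<^bold>\<setminus> y)) \<^bold>\<sqinter> z = z"
      using le_join_res[OF c z] meet_commute[of z] c z closed by (simp add: le_def)
    ultimately show "z \<preceq> x" by simp
  next
    assume "z \<preceq> x"
    then show "z \<preceq> (x \<^bold>\<setminus> y) \<^bold>\<setminus> x"
      using c z le_trans[of "(x \<^bold>\<setminus> y) \<^bold>\<sqinter> z" z x] by (simp add: closed le_res_iff meet_le)
  qed
qed (use c closed in auto)

text \<open>The two lattices may differ because the truth order of the product reverses the second
  coordinate.\<close>

lemma lattice_on_times:
  assumes "lattice_on S m j" "lattice_on S m' j'"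
  shows "lattice_on (S \<times> S) (\<lambda>(a1, a2) (b1, b2). (m a1 b1, m' a2 b2))
    (\<lambda>(a1, a2) (b1, b2). (j a1 b1, j' a2 b2))"
  using assms unfolding lattice_on_def by (auto simp: split_beta)

lemma implicative_bilattice_odot: "implicative_bilattice (odot L)"
proof
  show "lattice_on (carrier (odot L)) (tmeet (odot L)) (tjoin (odot L))"
    using lattice_on_times[OF lattice lattice[unfolded lattice_on_dual[of "carrier L" "lmeet L"]]]
    by (simp add: odot_def)
  show "lattice_on (carrier (odot L)) (kmeet (odot L)) (kjoin (odot L))"
    using lattice_on_times[OF lattice lattice] by (simp add: odot_def)
  fix x y
  assume c: "x \<in> carrier (odot L)" "y \<in> carrier (odot L)"
  obtain x1 x2 y1 y2 where [simp]: "x = (x1, x2)" "y = (y1, y2)" by fastforce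
  note c = c[unfolded odot_def, simplified]
  \<comment> \<open>IB5 by coordinates: the first is modus ponens under residuation; the second,
    where the truth meet is a join, is absorption.\<close>
  have "x1 \<^bold>\<sqinter> ((x1 \<^bold>\<setminus> y1) \<^bold>\<setminus> (x1 \<^bold>\<sqinter> y1)) = x1"
    using le_res_iff[of "x1 \<^bold>\<setminus> y1" "x1 \<^bold>\<sqinter> y1" x1] meet_commute[of x1 "x1 \<^bold>\<setminus> y1"]
      meet_res[of x1 y1] meet_idem[of "x1 \<^bold>\<sqinter> y1"] c by (simp add: closed le_def)
  moreover have "(x1 \<^bold>\<setminus> y1) \<^bold>\<sqinter> (x2 \<^bold>\<sqinter> y2) \<preceq> x2"
    using c le_trans[of _ "x2 \<^bold>\<sqinter> y2" x2] meet_le by (simp add: closed)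
  then have "x2 \<^bold>\<squnion> ((x1 \<^bold>\<setminus> y1) \<^bold>\<sqinter> (x2 \<^bold>\<sqinter> y2)) = x2"
    using c join_commute[of x2]
    by (simp add: closed le_iff_join)
  ultimately show "x \<^bold>\<and>\<^bsub>odot L\<^esub> ((x \<^bold>\<supset>\<^bsub>odot L\<^esub> y) \<^bold>\<supset>\<^bsub>odot L\<^esub> (x \<^bold>\<otimes>\<^bsub>odot L\<^esub> y)) = x"
    by (simp add: odot_def)
  assume "x \<^bold>\<and>\<^bsub>odot L\<^esub> y = x"
  \<comment> \<open>Negation swaps the coordinates, so the order in each is rewritten from meet to
    join form or back.\<close>
  then have "x1 \<^bold>\<squnion> y1 = y1" "y2 \<preceq> x2"
    using c join_commute[of x2]
    by (auto simp: odot_def le_iff_join simp flip: le_def)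
  then show "\<^bold>\<not>\<^bsub>odot L\<^esub> y \<^bold>\<and>\<^bsub>odot L\<^esub> \<^bold>\<not>\<^bsub>odot L\<^esub> x = \<^bold>\<not>\<^bsub>odot L\<^esub> y"
    using c join_commute[of x1]
    by (simp add: odot_def le_def)
qed (auto simp: odot_def closed res_self_res res_self_meet res_res res_res_self meet_assoc
    join_res join_meet_distrib)

end

section \<open>Negation as a symmetry of the two lattices of a bilattice\<close>

context bilattice
begin

lemma tmeet_closed: "\<lbrakk>x \<in> carrier B; y \<in> carrier B\<rbrakk> \<Longrightarrow> x \<^bold>\<and> y \<in> carrier B"
  and tjoin_closed: "\<lbrakk>x \<in> carrier B; y \<in> carrier B\<rbrakk> \<Longrightarrow> x \<^bold>\<or> y \<in> carrier B"
  and kmeet_closed: "\<lbrakk>x \<in> carrier B; y \<in> carrier B\<rbrakk> \<Longrightarrow> x \<^bold>\<otimes> y \<in> carrier B"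
  and kjoin_closed: "\<lbrakk>x \<in> carrier B; y \<in> carrier B\<rbrakk> \<Longrightarrow> x \<^bold>\<oplus> y \<in> carrier B"
  using truth_lattice knowledge_lattice
  by (simp_all add: lattice_on_meet_closed lattice_on_join_closed)

lemmas closed = tmeet_closed tjoin_closed kmeet_closed kjoin_closed neg_closed

lemmas truth_dual = truth_lattice[unfolded lattice_on_dual[of _ "tmeet B"]]
lemmas knowledge_dual = knowledge_lattice[unfolded lattice_on_dual[of _ "kmeet B"]]

text \<open>The antitone law with the target order read through joins, the form that
  \<open>lattice_on_involution_meet\<close> takes for the dual lattice.\<close>

lemma neg_truth_join:
  assumes "x \<in> carrier B" "y \<in> carrier B" "x \<^bold>\<and> y = x"
  shows "\<^bold>\<not> x \<^bold>\<or> \<^bold>\<not> y = \<^bold>\<not> x"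
  using neg_truth[OF assms] assms neg_closed lattice_on_meet_commute[OF truth_dual]
    lattice_on_le_iff[OF truth_lattice] by metis

lemma neg_join_truth:
  assumes "x \<in> carrier B" "y \<in> carrier B" "x \<^bold>\<or> y = x"
  shows "\<^bold>\<not> x \<^bold>\<and> \<^bold>\<not> y = \<^bold>\<not> x"
  using neg_truth[of y x] assms lattice_on_meet_commute[OF truth_dual]
    lattice_on_le_iff[OF truth_lattice] by metis

lemma neg_knowledge_join:
  assumes "x \<in> carrier B" "y \<in> carrier B" "x \<^bold>\<oplus> y = x"
  shows "\<^bold>\<not> x \<^bold>\<oplus> \<^bold>\<not> y = \<^bold>\<not> x"
  using neg_knowledge[of y x] assms neg_closed lattice_on_meet_commute[OF knowledge_dual]
    lattice_on_le_iff[OF knowledge_lattice] by metis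

text \<open>Negation is an isomorphism of the truth lattice onto its dual and an automorphism of the
  knowledge lattice.\<close>

lemma neg_ops:
  assumes "x \<in> carrier B" "y \<in> carrier B"
  shows neg_tmeet: "\<^bold>\<not> (x \<^bold>\<and> y) = \<^bold>\<not> x \<^bold>\<or> \<^bold>\<not> y"
    and neg_tjoin: "\<^bold>\<not> (x \<^bold>\<or> y) = \<^bold>\<not> x \<^bold>\<and> \<^bold>\<not> y"
    and neg_kmeet: "\<^bold>\<not> (x \<^bold>\<otimes> y) = \<^bold>\<not> x \<^bold>\<otimes> \<^bold>\<not> y"
    and neg_kjoin: "\<^bold>\<not> (x \<^bold>\<oplus> y) = \<^bold>\<not> x \<^bold>\<oplus> \<^bold>\<not> y"
proof -
  show "\<^bold>\<not> (x \<^bold>\<and> y) = \<^bold>\<not> x \<^bold>\<or> \<^bold>\<not> y"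
    by (rule lattice_on_involution_meet[OF truth_lattice truth_dual])
      (simp_all add: assms neg_closed neg_neg neg_truth_join neg_join_truth)
  show "\<^bold>\<not> (x \<^bold>\<or> y) = \<^bold>\<not> x \<^bold>\<and> \<^bold>\<not> y"
    by (rule lattice_on_involution_meet[OF truth_dual truth_lattice])
      (simp_all add: assms neg_closed neg_neg neg_truth_join neg_join_truth)
  show "\<^bold>\<not> (x \<^bold>\<otimes> y) = \<^bold>\<not> x \<^bold>\<otimes> \<^bold>\<not> y"
    by (rule lattice_on_involution_meet[OF knowledge_lattice knowledge_lattice])
      (simp_all add: assms neg_closed neg_neg neg_knowledge)
  show "\<^bold>\<not> (x \<^bold>\<oplus> y) = \<^bold>\<not> x \<^bold>\<oplus> \<^bold>\<not> y"
    by (rule lattice_on_involution_meet[OF knowledge_dual knowledge_dual])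
      (simp_all add: assms neg_closed neg_neg neg_knowledge_join)
qed

end

section \<open>Entailment in an implicative bilattice and the axioms of its reduct\<close>

context implicative_bilattice
begin

lemmas closed' = closed imp_closed

definition designated :: "'a \<Rightarrow> bool" where
  "designated e \<longleftrightarrow> e \<^bold>\<supset> e = e"

definition entails :: "'a \<Rightarrow> 'a \<Rightarrow> bool" where
  "entails x y \<longleftrightarrow> designated (x \<^bold>\<supset> y)"

lemma designated_imp: "\<lbrakk>e \<in> carrier B; x \<in> carrier B; designated e\<rbrakk> \<Longrightarrow> e \<^bold>\<supset> x = x"
  unfolding designated_def using IB1[of e x] by simp

lemma designated_imp_self: "x \<in> carrier B \<Longrightarrow> designated (x \<^bold>\<supset> x)"
  unfolding designated_def using IB1[of x "x \<^bold>\<supset> x"] imp_closed by simp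

lemma imp_imp: "\<lbrakk>x \<in> carrier B; y \<in> carrier B; z \<in> carrier B\<rbrakk> \<Longrightarrow> x \<^bold>\<supset> y \<^bold>\<supset> z = (x \<^bold>\<and> y) \<^bold>\<supset> z"
  and kmeet_imp: "\<lbrakk>x \<in> carrier B; y \<in> carrier B; z \<in> carrier B\<rbrakk> \<Longrightarrow> (x \<^bold>\<otimes> y) \<^bold>\<supset> z = x \<^bold>\<supset> y \<^bold>\<supset> z"
  using IB2[of x y z] by simp_all

lemma imp_exchange:
  "\<lbrakk>x \<in> carrier B; y \<in> carrier B; z \<in> carrier B\<rbrakk> \<Longrightarrow> x \<^bold>\<supset> y \<^bold>\<supset> z = y \<^bold>\<supset> x \<^bold>\<supset> z"
  using lattice_on_meet_commute[OF truth_lattice, of x y] by (simp add: imp_imp)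

lemma imp_contract: "\<lbrakk>x \<in> carrier B; z \<in> carrier B\<rbrakk> \<Longrightarrow> x \<^bold>\<supset> x \<^bold>\<supset> z = x \<^bold>\<supset> z"
  by (simp add: imp_imp lattice_on_meet_idem[OF truth_lattice])

lemma designated_weaken:
  assumes c: "x \<in> carrier B" "e \<in> carrier B" and e: "designated e"
  shows "designated (x \<^bold>\<supset> e)"
proof -
  have "((e \<^bold>\<supset> x) \<^bold>\<supset> e) \<^bold>\<supset> e = e \<^bold>\<supset> e"
    using IB3 c by simp
  then have "(x \<^bold>\<supset> e) \<^bold>\<supset> e = e"
    using designated_imp e c by simp
  then have "x \<^bold>\<supset> (x \<^bold>\<supset> e) \<^bold>\<supset> e = x \<^bold>\<supset> e"
    by simp
  then show ?thesis
    unfolding designated_def using imp_exchange[of x "x \<^bold>\<supset> e" e] c imp_closed by simp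
qed

text \<open>Here \<open>x \<supset> y\<close> is \<open>(x \<and> y) \<supset> y\<close>, which
  curries to a weakening of the designated \<open>y \<supset> y\<close>.\<close>

lemma truth_le_entails: "\<lbrakk>x \<in> carrier B; y \<in> carrier B; x \<^bold>\<and> y = x\<rbrakk> \<Longrightarrow> entails x y"
  unfolding entails_def
  using imp_imp[of x y y] designated_weaken[of x "y \<^bold>\<supset> y"] designated_imp_self imp_closed by simp

lemma knowledge_le_entails: "\<lbrakk>x \<in> carrier B; y \<in> carrier B; x \<^bold>\<otimes> y = x\<rbrakk> \<Longrightarrow> entails x y"
  unfolding entails_def
  using kmeet_imp[of x y y] designated_weaken[of x "y \<^bold>\<supset> y"] designated_imp_self imp_closed by simp

lemma entails_truth_le_kmeet:
  assumes "x \<in> carrier B" "y \<in> carrier B" "entails x y"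
  shows "x \<^bold>\<and> (x \<^bold>\<otimes> y) = x"
  using IB5[of x y] assms designated_imp[of "x \<^bold>\<supset> y" "x \<^bold>\<otimes> y"] imp_closed kmeet_closed
  by (simp add: entails_def)

text \<open>The antecedent \<open>x\<close> may be replaced by
  \<open>x \<and> (x \<otimes> y)\<close>, which curries into the antecedents \<open>x\<close>,
  \<open>x\<close>, \<open>y\<close>; contraction removes the repetition.\<close>

lemma entails_imp:
  assumes c: "x \<in> carrier B" "y \<in> carrier B" "z \<in> carrier B" and "entails x y"
  shows "x \<^bold>\<supset> y \<^bold>\<supset> z = x \<^bold>\<supset> z"
proof -
  have "x \<^bold>\<supset> z = (x \<^bold>\<and> (x \<^bold>\<otimes> y)) \<^bold>\<supset> z"
    using entails_truth_le_kmeet assms by simp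
  also have "\<dots> = x \<^bold>\<supset> x \<^bold>\<supset> y \<^bold>\<supset> z"
    using c closed by (simp add: kmeet_imp flip: imp_imp)
  also have "\<dots> = x \<^bold>\<supset> y \<^bold>\<supset> z"
    using c imp_contract imp_closed by simp
  finally show ?thesis by simp
qed

lemma entails_refl: "x \<in> carrier B \<Longrightarrow> entails x x"
  by (simp add: entails_def designated_imp_self)

lemma entails_trans:
  assumes "x \<in> carrier B" "y \<in> carrier B" "z \<in> carrier B" "entails x y" "entails y z"
  shows "entails x z"
  using entails_imp[of x y z] assms designated_weaken[of x "y \<^bold>\<supset> z"] imp_closed
  by (simp add: entails_def)

lemma tmeet_entails:
  assumes "x \<in> carrier B" "y \<in> carrier B"
  shows "entails (x \<^bold>\<and> y) x" "entails (x \<^bold>\<and> y) y"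
  using assms lattice_on_meet_le[OF truth_lattice] by (auto intro!: truth_le_entails closed)

lemma kmeet_entails:
  assumes "x \<in> carrier B" "y \<in> carrier B"
  shows "entails (x \<^bold>\<otimes> y) x" "entails (x \<^bold>\<otimes> y) y"
  using assms lattice_on_meet_le[OF knowledge_lattice] by (auto intro!: knowledge_le_entails closed)

lemma entails_tjoin:
  assumes "x \<in> carrier B" "y \<in> carrier B"
  shows "entails x (x \<^bold>\<or> y)" "entails y (x \<^bold>\<or> y)"
  using assms lattice_on_le_join[OF truth_lattice] by (auto intro!: truth_le_entails closed)

lemma entails_kjoin:
  assumes "x \<in> carrier B" "y \<in> carrier B"
  shows "entails x (x \<^bold>\<oplus> y)" "entails y (x \<^bold>\<oplus> y)"
  using assms lattice_on_le_join[OF knowledge_lattice] by (auto intro!: knowledge_le_entails closed)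

lemma entails_glb:
  assumes c: "x \<in> carrier B" "y \<in> carrier B" "z \<in> carrier B" and e: "entails z x" "entails z y"
  shows "entails z (x \<^bold>\<and> y)" "entails z (x \<^bold>\<otimes> y)"
proof -
  \<comment> \<open>Of either meet \<open>w\<close>, only the designation of
    \<open>x \<supset> y \<supset> w\<close> matters, so both are treated at once.\<close>
  have "entails z w" if w: "w \<in> carrier B" and d: "designated (x \<^bold>\<supset> y \<^bold>\<supset> w)" for w
  proof -
    have "z \<^bold>\<supset> w = z \<^bold>\<supset> x \<^bold>\<supset> y \<^bold>\<supset> w"
      using entails_imp[of z x "y \<^bold>\<supset> w"] entails_imp[of z y w] c e w imp_closed by simp
    then show ?thesis
      unfolding entails_def using designated_weaken[OF _ _ d] c w imp_closed by simp
  qed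
  then show "entails z (x \<^bold>\<and> y)" "entails z (x \<^bold>\<otimes> y)"
    using c designated_imp_self[of "x \<^bold>\<and> y"] designated_imp_self[of "x \<^bold>\<otimes> y"]
    by (simp_all add: closed imp_imp kmeet_imp)
qed

lemma entails_lub:
  assumes c: "x \<in> carrier B" "y \<in> carrier B" "z \<in> carrier B" and e: "entails x z" "entails y z"
  shows "entails (x \<^bold>\<or> y) z" "entails (x \<^bold>\<oplus> y) z"
proof -
  let ?p = "x \<^bold>\<supset> z" and ?q = "y \<^bold>\<supset> z"
  have p: "?p \<in> carrier B" "?q \<in> carrier B" using c imp_closed by auto
  \<comment> \<open>The implication of \<open>?p \<and> ?q\<close> by itself curries, and the
    designated antecedents \<open>?p\<close> and \<open>?q\<close> drop out. IB4 identifies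
    \<open>?p \<and> ?q\<close> with both implications in question.\<close>
  have "designated (?p \<^bold>\<and> ?q)"
    using imp_imp[of ?p ?q "?p \<^bold>\<and> ?q"] designated_imp_self[of "?p \<^bold>\<and> ?q"] p e closed
      designated_imp imp_closed by (simp add: entails_def)
  then show "entails (x \<^bold>\<or> y) z" "entails (x \<^bold>\<oplus> y) z"
    using IB4[of x y z] c by (simp_all add: entails_def)
qed

lemma entails_tmeet_iff:
  assumes c: "x \<in> carrier B" "y \<in> carrier B" "z \<in> carrier B"
  shows "entails (x \<^bold>\<and> y) z \<longleftrightarrow> entails x (y \<^bold>\<supset> z)"
  using assms by (simp add: entails_def imp_imp)

lemma imp_distrib:
  assumes c: "x \<in> carrier B" "y \<in> carrier B" "z \<in> carrier B"
  shows "(x \<^bold>\<supset> y) \<^bold>\<supset> (x \<^bold>\<supset> z) = x \<^bold>\<supset> y \<^bold>\<supset> z"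
proof -
  let ?u = "x \<^bold>\<and> (x \<^bold>\<supset> y)"
  have u: "?u \<in> carrier B" using c closed' by simp
  have "entails ((x \<^bold>\<supset> y) \<^bold>\<and> x) y"
    using c imp_closed by (simp add: entails_tmeet_iff entails_refl)
  then have "entails ?u y"
    using lattice_on_meet_commute[OF truth_lattice, of x] c imp_closed by simp
  have "(x \<^bold>\<supset> y) \<^bold>\<supset> (x \<^bold>\<supset> z) = ?u \<^bold>\<supset> z"
    using c imp_closed imp_exchange[of x] by (simp flip: imp_imp)
  also have "\<dots> = ?u \<^bold>\<supset> y \<^bold>\<supset> z"
    using entails_imp[OF u _ _ \<open>entails ?u y\<close>] c by simp
  also have "\<dots> = (x \<^bold>\<and> y) \<^bold>\<supset> (x \<^bold>\<supset> y) \<^bold>\<supset> z"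
    using c closed' imp_exchange[of y "x \<^bold>\<supset> y"] by (simp flip: imp_imp)
  also have "\<dots> = (x \<^bold>\<and> y) \<^bold>\<supset> z"
  proof (rule entails_imp)
    have "entails y (x \<^bold>\<supset> y)"
      unfolding entails_def
      using c imp_closed imp_exchange[of y x y] designated_imp_self designated_weaken by simp
    then show "entails (x \<^bold>\<and> y) (x \<^bold>\<supset> y)"
      using c closed' tmeet_entails entails_trans[of "x \<^bold>\<and> y" y] by simp
  qed (use c closed' in auto)
  finally show ?thesis using c imp_imp by simp
qed

text \<open>Entailment from \<open>u\<close> to \<open>v\<close> puts \<open>u\<close> below
  \<open>u \<otimes> v\<close> in the truth order. The same for the negations, negated back, gives
  the reverse inequality, since negation commutes with \<open>\<otimes>\<close>. Hence
  \<open>x\<close> and \<open>y\<close> both equal \<open>x \<otimes> y\<close>.\<close>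

lemma entails_antisym:
  assumes c: "x \<in> carrier B" "y \<in> carrier B"
    and e: "entails x y" "entails y x" "entails (\<^bold>\<not> x) (\<^bold>\<not> y)" "entails (\<^bold>\<not> y) (\<^bold>\<not> x)"
  shows "x = y"
proof -
  have *: "u = u \<^bold>\<otimes> v"
    if "u \<in> carrier B" "v \<in> carrier B" "entails u v" "entails (\<^bold>\<not> u) (\<^bold>\<not> v)" for u v
  proof (rule lattice_on_le_antisym[OF truth_lattice])
    show "u \<^bold>\<and> (u \<^bold>\<otimes> v) = u"
      using that entails_truth_le_kmeet by simp
    have "\<^bold>\<not> u \<^bold>\<and> \<^bold>\<not> (u \<^bold>\<otimes> v) = \<^bold>\<not> u"
      using that entails_truth_le_kmeet closed neg_kmeet by simp
    then show "(u \<^bold>\<otimes> v) \<^bold>\<and> u = u \<^bold>\<otimes> v"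
      using neg_truth[of "\<^bold>\<not> u" "\<^bold>\<not> (u \<^bold>\<otimes> v)"] that closed neg_neg by simp
  qed (use that closed in auto)
  show ?thesis
    using *[of x y] *[of y x] c e lattice_on_meet_commute[OF knowledge_lattice, of x y] by simp
qed

lemma neg_imp_entails_iff:
  assumes "x \<in> carrier B" "y \<in> carrier B" "z \<in> carrier B"
  shows "entails (\<^bold>\<not> (x \<^bold>\<supset> y)) z \<longleftrightarrow> entails (x \<^bold>\<and> \<^bold>\<not> y) z"
  using IB6[of x y z] assms by (simp add: entails_def)

text \<open>By IB6 the two elements have the same consequences, and each of them is a consequence of
  itself.\<close>

lemma neg_imp_entails:
  assumes c: "x \<in> carrier B" "y \<in> carrier B"
  shows "entails (\<^bold>\<not> (x \<^bold>\<supset> y)) (x \<^bold>\<and> \<^bold>\<not> y)" "entails (x \<^bold>\<and> \<^bold>\<not> y) (\<^bold>\<not> (x \<^bold>\<supset> y))"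
  using neg_imp_entails_iff[OF c, of "x \<^bold>\<and> \<^bold>\<not> y"]
    neg_imp_entails_iff[OF c, of "\<^bold>\<not> (x \<^bold>\<supset> y)"] c
  by (simp_all add: entails_refl closed')

text \<open>Up to mutual entailment the negated implications are \<open>e \<and> \<not> x\<close>
  and \<open>e \<and> \<not> y\<close>, and \<open>e\<close> carries the former to the
  latter.\<close>

lemma tmeet_neg_entails:
  assumes c: "e \<in> carrier B" "x \<in> carrier B" "y \<in> carrier B" and e: "entails e (\<^bold>\<not> x \<^bold>\<supset> \<^bold>\<not> y)"
  shows "entails (\<^bold>\<not> (e \<^bold>\<supset> x)) (\<^bold>\<not> (e \<^bold>\<supset> y))"
proof -
  have "entails (e \<^bold>\<and> \<^bold>\<not> x) (e \<^bold>\<and> \<^bold>\<not> y)"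
    using c e closed by (intro entails_glb) (simp_all add: tmeet_entails entails_tmeet_iff)
  then have "entails (e \<^bold>\<and> \<^bold>\<not> x) (\<^bold>\<not> (e \<^bold>\<supset> y))"
    by (rule entails_trans[OF _ _ _ _ neg_imp_entails(2), rotated 3]) (use c closed' in auto)
  then show ?thesis
    using neg_imp_entails_iff c closed' by simp
qed

text \<open>The core of I6, with \<open>e\<close> standing for the meet of the four premises of
  \<open>p_term\<close>. To apply \<open>entails_antisym\<close>, \<open>imp_distrib\<close> handles
  the implications and \<open>tmeet_neg_entails\<close> their negations.\<close>

lemma imp_eq_of_entails:
  assumes c: "e \<in> carrier B" "x \<in> carrier B" "y \<in> carrier B"
    and e: "entails e (x \<^bold>\<supset> y)" "entails e (y \<^bold>\<supset> x)"
      "entails e (\<^bold>\<not> x \<^bold>\<supset> \<^bold>\<not> y)" "entails e (\<^bold>\<not> y \<^bold>\<supset> \<^bold>\<not> x)"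
  shows "e \<^bold>\<supset> x = e \<^bold>\<supset> y"
proof (rule entails_antisym)
  show "entails (e \<^bold>\<supset> x) (e \<^bold>\<supset> y)" "entails (e \<^bold>\<supset> y) (e \<^bold>\<supset> x)"
    using e c imp_distrib by (simp_all add: entails_def)
qed (use c closed' e tmeet_neg_entails in auto)

text \<open>Makes the quotient construction available for \<open>B\<close> itself, with entailment
  as the preorder behind \<open>sim\<close>.\<close>

sublocale reduct: i_algebra B
proof
  show "carrier B \<noteq> {}"
    using truth_lattice by (simp add: lattice_on_def)
  show "x \<^bold>\<supset> (y \<^bold>\<supset> z) = (x \<^bold>\<supset> y) \<^bold>\<supset> (x \<^bold>\<supset> z) \<and> (x \<^bold>\<supset> y) \<^bold>\<supset> (x \<^bold>\<supset> z) = y \<^bold>\<supset> (x \<^bold>\<supset> z)"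
    if "x \<in> carrier B" "y \<in> carrier B" "z \<in> carrier B" for x y z
    using that imp_distrib imp_exchange by simp
  show "x \<^bold>\<supset> (\<^bold>\<not> y \<^bold>\<supset> z) = \<^bold>\<not> (x \<^bold>\<supset> y) \<^bold>\<supset> z"
    if "x \<in> carrier B" "y \<in> carrier B" "z \<in> carrier B" for x y z
    using that IB6 imp_imp closed by simp
  show "p_term B x y x = p_term B x y y" if c: "x \<in> carrier B" "y \<in> carrier B" for x y
  proof -
    let ?a = "x \<^bold>\<supset> y" and ?b = "y \<^bold>\<supset> x" and ?c = "\<^bold>\<not> x \<^bold>\<supset> \<^bold>\<not> y" and ?d = "\<^bold>\<not> y \<^bold>\<supset> \<^bold>\<not> x"
    \<comment> \<open>Currying turns the four nested premises of \<open>p_term\<close> into this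
      single antecedent.\<close>
    let ?e = "?a \<^bold>\<and> (?b \<^bold>\<and> (?c \<^bold>\<and> ?d))"
    have p: "p_term B x y z = ?e \<^bold>\<supset> z" if "z \<in> carrier B" for z
      using that c closed' by (simp add: p_term_def flip: imp_imp)
    have left: "entails (u \<^bold>\<and> v) w" and right: "entails (v \<^bold>\<and> u) w"
      if "entails u w" "u \<in> carrier B" "v \<in> carrier B" "w \<in> carrier B" for u v w
      using that tmeet_entails[of u v] tmeet_entails[of v u] closed
        entails_trans[of "u \<^bold>\<and> v" u w] entails_trans[of "v \<^bold>\<and> u" u w] by simp_all
    have in_carrier: "?a \<in> carrier B" "?b \<in> carrier B" "?c \<in> carrier B" "?d \<in> carrier B"
      using c closed' by simp_all
    have "entails ?e ?a" "entails ?e ?b" "entails ?e ?c" "entails ?e ?d"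
      using in_carrier closed by (simp_all add: left right entails_refl)
    then have "?e \<^bold>\<supset> x = ?e \<^bold>\<supset> y"
      using c in_carrier by (intro imp_eq_of_entails) (simp_all add: closed)
    then show ?thesis using p c by simp
  qed
qed (simp_all add: closed' IB1 IB3 neg_neg)

lemma reduct_le: "reduct.le x y \<longleftrightarrow> entails x y"
  by (simp add: reduct.le_def reduct.valid_def entails_def designated_def)

end

section \<open>Bilattice homomorphisms and generated subalgebras\<close>

lemma generated_subset_carrier:
  assumes "implicative_bilattice B" "X \<subseteq> carrier B"
  shows "generated B X \<subseteq> carrier B"
proof
  interpret implicative_bilattice B by fact
  fix x assume "x \<in> generated B X"
  then show "x \<in> carrier B"
    by induction (use assms closed' in auto)
qed

lemma bilat_homD:
  assumes "f \<in> bilat_hom B C"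
  shows bilat_hom_closed: "x \<in> carrier B \<Longrightarrow> f x \<in> carrier C"
    and bilat_hom_neg: "x \<in> carrier B \<Longrightarrow> f (\<^bold>\<not>\<^bsub>B\<^esub> x) = \<^bold>\<not>\<^bsub>C\<^esub> f x"
    and bilat_hom_imp: "\<lbrakk>x \<in> carrier B; y \<in> carrier B\<rbrakk> \<Longrightarrow> f (x \<^bold>\<supset>\<^bsub>B\<^esub> y) = f x \<^bold>\<supset>\<^bsub>C\<^esub> f y"
    and bilat_hom_tmeet: "\<lbrakk>x \<in> carrier B; y \<in> carrier B\<rbrakk> \<Longrightarrow> f (x \<^bold>\<and>\<^bsub>B\<^esub> y) = f x \<^bold>\<and>\<^bsub>C\<^esub> f y"
    and bilat_hom_tjoin: "\<lbrakk>x \<in> carrier B; y \<in> carrier B\<rbrakk> \<Longrightarrow> f (x \<^bold>\<or>\<^bsub>B\<^esub> y) = f x \<^bold>\<or>\<^bsub>C\<^esub> f y"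
    and bilat_hom_kmeet: "\<lbrakk>x \<in> carrier B; y \<in> carrier B\<rbrakk> \<Longrightarrow> f (x \<^bold>\<otimes>\<^bsub>B\<^esub> y) = f x \<^bold>\<otimes>\<^bsub>C\<^esub> f y"
    and bilat_hom_kjoin: "\<lbrakk>x \<in> carrier B; y \<in> carrier B\<rbrakk> \<Longrightarrow> f (x \<^bold>\<oplus>\<^bsub>B\<^esub> y) = f x \<^bold>\<oplus>\<^bsub>C\<^esub> f y"
  using assms by (auto simp: bilat_hom_def imp_neg_hom_def)

lemmas bilat_hom_ops = bilat_hom_neg bilat_hom_imp bilat_hom_tmeet bilat_hom_tjoin
  bilat_hom_kmeet bilat_hom_kjoin

lemma bilat_hom_eq_on_generated:
  assumes B: "implicative_bilattice B" and X: "X \<subseteq> carrier B"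
    and f: "f \<in> bilat_hom B C" and g: "g \<in> bilat_hom B C"
    and eq: "\<And>x. x \<in> X \<Longrightarrow> f x = g x" and "x \<in> generated B X"
  shows "f x = g x"
proof -
  note [simp] = subsetD[OF generated_subset_carrier[OF B X]]
  show ?thesis
    using \<open>x \<in> generated B X\<close>
    by induction (simp_all add: eq bilat_hom_ops[OF f] bilat_hom_ops[OF g])
qed

text \<open>A homomorphic image is closed under all operations; this later makes
  \<open>canon B\<close> onto.\<close>

lemma generated_image_subset:
  assumes B: "implicative_bilattice B" and f: "f \<in> bilat_hom B C"
  shows "generated C (f ` carrier B) \<subseteq> f ` carrier B"
proof
  interpret implicative_bilattice B by fact
  fix x assume "x \<in> generated C (f ` carrier B)"
  then show "x \<in> f ` carrier B"
    by induction (auto simp: closed' simp flip: bilat_hom_ops[OF f])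
qed

lemma bilat_hom_comp:
  assumes f: "f \<in> bilat_hom B C" and g: "g \<in> bilat_hom C D"
  shows "g \<circ> f \<in> bilat_hom B D"
  using assms by (auto simp: bilat_hom_def imp_neg_hom_def Pi_iff)

lemma bilat_hom_inv_into:
  assumes B: "implicative_bilattice B" and f: "f \<in> bilat_hom B C"
    and bij: "bij_betw f (carrier B) (carrier C)"
  shows "inv_into (carrier B) f \<in> bilat_hom C B"
proof -
  interpret implicative_bilattice B by fact
  have inv: "inv_into (carrier B) f (f x) = x" if "x \<in> carrier B" for x
    using that bij by (simp add: bij_betw_def)
  have C: "carrier C = f ` carrier B"
    using bij by (simp add: bij_betw_def)
  show ?thesis
    unfolding bilat_hom_def imp_neg_hom_def C
    by (auto simp: inv closed' simp flip: bilat_hom_ops[OF f])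
qed

text \<open>Values outside the carrier are arbitrary, so uniqueness is meant among extensional
  functions; restriction supplies the representative.\<close>

lemma restrict_bilat_hom:
  assumes "implicative_bilattice B" "f \<in> bilat_hom B C"
  shows "restrict f (carrier B) \<in> bilat_hom B C"
proof -
  interpret implicative_bilattice B by fact
  show ?thesis
    using assms(2) closed' by (auto simp: bilat_hom_def imp_neg_hom_def)
qed

section \<open>The canonical embedding and the algebra it generates\<close>

context i_algebra
begin

lemma carrier_odot_quot: "carrier (odot (quot A)) = cls A ` carrier A \<times> cls A ` carrier A"
  by (simp add: odot_def quot_carrier)

lemma implicative_bilattice_odot_quot: "implicative_bilattice (odot (quot A))"
  by (rule classical_implicative_lattice.implicative_bilattice_odot)
    (rule classical_implicative_lattice_quot)

text \<open>For implication, the second coordinate matches because I5 makes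
  \<open>\<not> (a \<supset> b)\<close> equal to \<open>conj a (\<not> b)\<close>.\<close>

lemma canon_hom: "canon A \<in> imp_neg_hom A (odot (quot A))"
  by (auto simp: imp_neg_hom_def canon_def imp_closed neg_closed I5 conj_def odot_def quot_ops
      quot_carrier)

lemma canon_image: "canon A ` carrier A \<subseteq> carrier (odot (quot A))"
  using canon_hom by (auto simp: imp_neg_hom_def)

text \<open>When all four premises of \<open>p\<close> are valid, axiom \<open>I6\<close> reads \<open>a = b\<close>.\<close>

lemma canon_inj: "inj_on (canon A) (carrier A)"
proof (rule inj_onI)
  fix a b assume c: "a \<in> carrier A" "b \<in> carrier A" and eq: "canon A a = canon A b"
  have p: "p_term A a b x = x" if "x \<in> carrier A" for x
    using eq c that unfolding canon_def p_term_def
    by (simp add: cls_eq neg_closed le_def valid_imp imp_closed)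
  show "a = b"
    using I6[OF c] p c by simp
qed

text \<open>The pair \<open>(1, 1)\<close> is the \<open>\<oplus>\<close>-join of \<open>h (e \<supset> e)\<close> and its negation, and
  \<open>(a, b) = (h a \<and> (1, 1)) \<otimes> (\<not> h b \<or> (1, 1))\<close>.\<close>

lemma generated_canon: "generated (odot (quot A)) (canon A ` carrier A) = carrier (odot (quot A))"
proof
  let ?B = "odot (quot A)"
  let ?G = "generated ?B (canon A ` carrier A)"
  show "?G \<subseteq> carrier ?B"
    by (intro generated_subset_carrier implicative_bilattice_odot_quot canon_image)
  show "carrier ?B \<subseteq> ?G"
  proof
    fix x assume "x \<in> carrier ?B"
    then obtain a b where c: "a \<in> carrier A" "b \<in> carrier A" and x: "x = (cls A a, cls A b)"
      by (auto simp: carrier_odot_quot)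
    let ?e = "a \<^bold>\<supset> a"
    have e: "?e \<in> carrier A" "valid ?e" "\<^bold>\<not> ?e \<in> carrier A"
      using c imp_closed neg_closed valid_self by simp_all
    have le_e: "le u ?e" if "u \<in> carrier A" for u
      using that e valid_weaken by (simp add: le_def)
    let ?top = "canon A ?e \<^bold>\<oplus>\<^bsub>?B\<^esub> \<^bold>\<not>\<^bsub>?B\<^esub> canon A ?e"
    have h: "canon A u \<in> ?G" if "u \<in> carrier A" for u
      using that by (simp add: generated.incl)
    have top: "?top = (cls A ?e, cls A ?e)"
      using e disj_le le_disj1 le_disj2 le_e
      by (simp add: canon_def odot_def quot_ops cls_eq disj_closed)
    \<comment> \<open>The class of \<open>?e\<close> is the top, so \<open>conj u ?e\<close> is
      equivalent to \<open>u\<close> and \<open>disj v ?e\<close> to the top. The first order of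
      factors arises in the first coordinate, the other in the second.\<close>
    have "cls A (conj (conj u ?e) (disj v ?e)) = cls A u"
      "cls A (conj (disj v ?e) (conj u ?e)) = cls A u"
      if "u \<in> carrier A" "v \<in> carrier A" for u v
      using that e
      by (simp_all add: cls_eq conj_closed disj_closed le_conj le_e le_refl le_disj2' conj_le1' conj_le2')
    then have "x = (canon A a \<^bold>\<and>\<^bsub>?B\<^esub> ?top) \<^bold>\<otimes>\<^bsub>?B\<^esub> (\<^bold>\<not>\<^bsub>?B\<^esub> canon A b \<^bold>\<or>\<^bsub>?B\<^esub> ?top)"
      using c e unfolding top x
      by (simp add: canon_def odot_def quot_ops conj_closed disj_closed neg_closed)
    moreover have "?top \<in> ?G"
      using h e by (simp add: generated.kjoin generated.neg)
    ultimately show "x \<in> ?G"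
      using h c by (metis generated.tmeet generated.tjoin generated.kmeet generated.neg)
  qed
qed

text \<open>Meets in the quotient are determined by the preorder alone. Both meets of an implicative
  bilattice are greatest lower bounds for entailment, so they induce the same operation on
  classes.\<close>

lemma cls_glb:
  assumes c: "a \<in> carrier A" "b \<in> carrier A" "g \<in> carrier A"
    and g: "le g a" "le g b" "\<And>c. \<lbrakk>c \<in> carrier A; le c a; le c b\<rbrakk> \<Longrightarrow> le c g"
  shows "cls A g = lmeet (quot A) (cls A a) (cls A b)"
  using c g(1,2) g(3)[of "conj a b"]
  by (simp add: quot_ops cls_eq conj_closed le_conj conj_le1 conj_le2)

lemma cls_lub:
  assumes c: "a \<in> carrier A" "b \<in> carrier A" "g \<in> carrier A"
    and g: "le a g" "le b g" "\<And>c. \<lbrakk>c \<in> carrier A; le a c; le b c\<rbrakk> \<Longrightarrow> le g c"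
  shows "cls A g = ljoin (quot A) (cls A a) (cls A b)"
  using c g(1,2) g(3)[of "disj a b"]
  by (simp add: quot_ops cls_eq disj_closed disj_le le_disj1 le_disj2)

end

section \<open>Every implicative bilattice is isomorphic to its product bilattice\<close>

context implicative_bilattice
begin

lemma cls_ops:
  assumes c: "x \<in> carrier B" "y \<in> carrier B"
  shows "cls B (x \<^bold>\<and> y) = lmeet (quot B) (cls B x) (cls B y)"
    and "cls B (x \<^bold>\<otimes> y) = lmeet (quot B) (cls B x) (cls B y)"
    and "cls B (x \<^bold>\<or> y) = ljoin (quot B) (cls B x) (cls B y)"
    and "cls B (x \<^bold>\<oplus> y) = ljoin (quot B) (cls B x) (cls B y)"
proof -
  show "cls B (x \<^bold>\<and> y) = lmeet (quot B) (cls B x) (cls B y)"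
    "cls B (x \<^bold>\<otimes> y) = lmeet (quot B) (cls B x) (cls B y)"
    by (rule reduct.cls_glb; simp add: c reduct_le closed tmeet_entails kmeet_entails entails_glb)+
  show "cls B (x \<^bold>\<or> y) = ljoin (quot B) (cls B x) (cls B y)"
    "cls B (x \<^bold>\<oplus> y) = ljoin (quot B) (cls B x) (cls B y)"
    by (rule reduct.cls_lub; simp add: c reduct_le closed entails_tjoin entails_kjoin entails_lub)+
qed

text \<open>In the second coordinate \<open>neg_ops\<close> exchanges truth meets and joins but
  keeps the knowledge operations, exactly as in \<open>odot\<close>.\<close>

lemma canon_bilat_hom: "canon B \<in> bilat_hom B (odot (quot B))"
  unfolding bilat_hom_def using reduct.canon_hom
  by (auto simp: canon_def odot_def neg_ops cls_ops neg_closed)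

lemma canon_bij: "bij_betw (canon B) (carrier B) (carrier (odot (quot B)))"
proof -
  have "carrier (odot (quot B)) \<subseteq> canon B ` carrier B"
    using generated_image_subset[OF implicative_bilattice_axioms canon_bilat_hom]
    by (simp add: reduct.generated_canon)
  then show ?thesis
    using reduct.canon_image reduct.canon_inj by (auto simp: bij_betw_def)
qed

end

section \<open>The map induced on quotients by a homomorphism\<close>

locale i_algebra_hom = dom: i_algebra A + cod: i_algebra C
  for A :: "('a, 'm) imp_neg_scheme" and C :: "('b, 'n) imp_neg_scheme" +
  fixes f
  assumes hom: "f \<in> imp_neg_hom A C"
begin

lemma hom_closed: "a \<in> carrier A \<Longrightarrow> f a \<in> carrier C"
  and hom_imp: "\<lbrakk>a \<in> carrier A; b \<in> carrier A\<rbrakk> \<Longrightarrow> f (a \<^bold>\<supset>\<^bsub>A\<^esub> b) = f a \<^bold>\<supset>\<^bsub>C\<^esub> f b"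
  and hom_neg: "a \<in> carrier A \<Longrightarrow> f (\<^bold>\<not>\<^bsub>A\<^esub> a) = \<^bold>\<not>\<^bsub>C\<^esub> f a"
  using hom by (auto simp: imp_neg_hom_def)

lemma hom_conj: "\<lbrakk>a \<in> carrier A; b \<in> carrier A\<rbrakk> \<Longrightarrow> f (dom.conj a b) = cod.conj (f a) (f b)"
  and hom_disj: "\<lbrakk>a \<in> carrier A; b \<in> carrier A\<rbrakk> \<Longrightarrow> f (dom.disj a b) = cod.disj (f a) (f b)"
  by (simp_all add: dom.conj_def cod.conj_def dom.disj_def cod.disj_def hom_imp hom_neg
      dom.imp_closed dom.neg_closed)

text \<open>Validity of an implication is an equation between terms, so \<open>f\<close> preserves
  it, and reflects it when injective.\<close>

lemma hom_le:
  assumes "a \<in> carrier A" "b \<in> carrier A" "dom.le a b"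
  shows "cod.le (f a) (f b)"
  using assms unfolding dom.le_def cod.le_def dom.valid_def cod.valid_def
  by (metis hom_imp dom.imp_closed)

lemma hom_le_iff:
  assumes "inj_on f (carrier A)" "a \<in> carrier A" "b \<in> carrier A"
  shows "cod.le (f a) (f b) \<longleftrightarrow> dom.le a b"
  using assms inj_on_eq_iff[OF assms(1), of "(a \<^bold>\<supset>\<^bsub>A\<^esub> b) \<^bold>\<supset>\<^bsub>A\<^esub> (a \<^bold>\<supset>\<^bsub>A\<^esub> b)" "a \<^bold>\<supset>\<^bsub>A\<^esub> b"]
  by (simp add: dom.le_def cod.le_def dom.valid_def cod.valid_def hom_imp dom.imp_closed)

text \<open>The union avoids choosing a representative; over a class all its members coincide, by
  \<open>quot_map_cls\<close>.\<close>

definition quot_map :: "'a set \<Rightarrow> 'b set" where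
  "quot_map X = (\<Union>a\<in>X. cls C (f a))"

lemma quot_map_cls:
  assumes a: "a \<in> carrier A"
  shows "quot_map (cls A a) = cls C (f a)"
proof -
  have "cls C (f b) = cls C (f a)" if "b \<in> cls A a" for b
    using that a by (auto simp: cls_def[of A] dom.sim_iff cod.cls_eq hom_closed hom_le)
  moreover have "a \<in> cls A a"
    using a by (simp add: cls_def dom.sim_iff dom.le_refl)
  ultimately show ?thesis
    unfolding quot_map_def by blast
qed

lemma quot_map_ops:
  assumes "X \<in> carrier (quot A)" "Y \<in> carrier (quot A)"
  shows "quot_map (lmeet (quot A) X Y) = lmeet (quot C) (quot_map X) (quot_map Y)"
    and "quot_map (ljoin (quot A) X Y) = ljoin (quot C) (quot_map X) (quot_map Y)"
    and "quot_map (lres (quot A) X Y) = lres (quot C) (quot_map X) (quot_map Y)"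
  using assms
  by (auto simp: dom.quot_carrier dom.quot_ops cod.quot_ops quot_map_cls dom.conj_disj_closed
      dom.imp_closed hom_closed hom_conj hom_disj hom_imp)

lemma quot_map_closed: "X \<in> carrier (quot A) \<Longrightarrow> quot_map X \<in> carrier (quot C)"
  by (auto simp: dom.quot_carrier cod.quot_carrier quot_map_cls hom_closed)

lemma map_prod_quot_map_hom: "map_prod quot_map quot_map \<in> bilat_hom (odot (quot A)) (odot (quot C))"
  by (auto simp: bilat_hom_def imp_neg_hom_def odot_def quot_map_closed quot_map_ops)

text \<open>Naturality of \<open>canon\<close>; the second coordinate uses that \<open>f\<close>
  preserves negation.\<close>

lemma map_prod_quot_map_canon:
  "a \<in> carrier A \<Longrightarrow> map_prod quot_map quot_map (canon A a) = canon C (f a)"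
  by (simp add: canon_def quot_map_cls dom.neg_closed hom_neg)

lemma inj_on_quot_map:
  assumes "inj_on f (carrier A)"
  shows "inj_on quot_map (carrier (quot A))"
  using hom_le_iff[OF assms]
  by (auto simp: inj_on_def dom.quot_carrier quot_map_cls dom.cls_eq cod.cls_eq hom_closed)

end

section \<open>Extension of homomorphisms and the universal property\<close>

lemma bilat_hom_extension:
  fixes A :: "('a, 'm) imp_neg_scheme" and B :: "('b, 'n) bilat_scheme"
  assumes A: "i_algebra A" and B: "implicative_bilattice B" and f: "f \<in> imp_neg_hom A B"
  obtains g where "g \<in> bilat_hom (odot (quot A)) B" "\<And>a. a \<in> carrier A \<Longrightarrow> g (canon A a) = f a"
    "inj_on f (carrier A) \<Longrightarrow> inj_on g (carrier (odot (quot A)))"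
proof
  interpret B: implicative_bilattice B by fact
  interpret i_algebra_hom A B f
    using A B.reduct.i_algebra_axioms f by (simp add: i_algebra_hom_def i_algebra_hom_axioms_def)
  let ?q = "map_prod quot_map quot_map" and ?i = "inv_into (carrier B) (canon B)"
  show "?i \<circ> ?q \<in> bilat_hom (odot (quot A)) B"
    using bilat_hom_comp[OF map_prod_quot_map_hom]
      bilat_hom_inv_into[OF B B.canon_bilat_hom B.canon_bij] .
  \<comment> \<open>By naturality \<open>?q\<close> sends \<open>canon A a\<close> to
    \<open>canon B (f a)\<close>, and \<open>?i\<close> cancels \<open>canon B\<close>.\<close>
  show "(?i \<circ> ?q) (canon A a) = f a" if "a \<in> carrier A" for a
    using that by (simp add: map_prod_quot_map_canon B.reduct.canon_inj hom_closed)
  assume "inj_on f (carrier A)"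
  then have "inj_on ?q (carrier (odot (quot A)))"
    using map_prod_inj_on[OF inj_on_quot_map inj_on_quot_map] by (simp add: odot_def)
  moreover have "inj_on ?i (?q ` carrier (odot (quot A)))"
  proof (rule inj_on_subset)
    show "inj_on ?i (carrier (odot (quot B)))"
      by (rule bij_betw_imp_inj_on[OF bij_betw_inv_into[OF B.canon_bij]])
    show "?q ` carrier (odot (quot A)) \<subseteq> carrier (odot (quot B))"
      by (rule image_subsetI) (rule bilat_hom_closed[OF map_prod_quot_map_hom])
  qed
  ultimately show "inj_on (?i \<circ> ?q) (carrier (odot (quot A)))"
    by (rule comp_inj_on)
qed

theorem theorem5p5p7:
  fixes A :: "('a, 'm) imp_neg_scheme"
  assumes "i_algebra A"
  shows "(implicative_bilattice (odot (quot A)) \<and>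
          canon A \<in> imp_neg_hom A (odot (quot A)) \<and> inj_on (canon A) (carrier A)) \<and>
         generated (odot (quot A)) (canon A ` carrier A) = carrier (odot (quot A)) \<and>
         (\<forall>(B' :: ('b, 'n) bilat_scheme) f.
            implicative_bilattice B' \<and> f \<in> imp_neg_hom A B' \<longrightarrow>
            (\<exists>!f'. f' \<in> extensional (carrier (odot (quot A))) \<and>
                   f' \<in> bilat_hom (odot (quot A)) B' \<and>
                   (\<forall>a\<in>carrier A. f' (canon A a) = f a)) \<and>
            (inj_on f (carrier A) \<longrightarrow>
              (\<forall>f'\<in>bilat_hom (odot (quot A)) B'.
                 (\<forall>a\<in>carrier A. f' (canon A a) = f a) \<longrightarrow>
                 inj_on f' (carrier (odot (quot A))))))"
proof (intro conjI allI impI ballI; (elim conjE)?)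
  interpret A: i_algebra A by fact
  let ?B = "odot (quot A)"
  show B: "implicative_bilattice ?B"
    by (rule A.implicative_bilattice_odot_quot)
  show "canon A \<in> imp_neg_hom A ?B" "inj_on (canon A) (carrier A)"
    by (rule A.canon_hom A.canon_inj)+
  show gen: "generated ?B (canon A ` carrier A) = carrier ?B"
    by (rule A.generated_canon)
  fix B' :: "('b, 'n) bilat_scheme" and f
  assume B': "implicative_bilattice B'" and f: "f \<in> imp_neg_hom A B'"
  obtain g where g: "g \<in> bilat_hom ?B B'" "\<And>a. a \<in> carrier A \<Longrightarrow> g (canon A a) = f a"
    and inj: "inj_on f (carrier A) \<Longrightarrow> inj_on g (carrier ?B)"
    using bilat_hom_extension[OF assms B' f] by blast
  \<comment> \<open>Agreement on generators forces agreement on the carrier. This serves both the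
    uniqueness claim and the injectivity of an arbitrary extension.\<close>
  have unique: "k x = g x"
    if "k \<in> bilat_hom ?B B'" "\<forall>a\<in>carrier A. k (canon A a) = f a" "x \<in> carrier ?B" for k x
  proof (rule bilat_hom_eq_on_generated[OF B A.canon_image that(1) g(1)])
    show "x \<in> generated ?B (canon A ` carrier A)"
      using that(3) gen by simp
  qed (use that(2) g(2) in auto)
  show "\<exists>!f'. f' \<in> extensional (carrier ?B) \<and> f' \<in> bilat_hom ?B B' \<and>
      (\<forall>a\<in>carrier A. f' (canon A a) = f a)"
  proof (intro ex1I conjI ballI; (elim conjE)?)
    show "restrict g (carrier ?B) \<in> bilat_hom ?B B'"
      by (rule restrict_bilat_hom[OF B g(1)])
    show "restrict g (carrier ?B) (canon A a) = f a" if "a \<in> carrier A" for a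
      using that g(2) A.canon_image by auto
    show "k = restrict g (carrier ?B)"
      if "k \<in> extensional (carrier ?B)" "k \<in> bilat_hom ?B B'"
        "\<forall>a\<in>carrier A. k (canon A a) = f a" for k
      using that unique by (intro extensionalityI[of _ "carrier ?B"]) auto
  qed simp
  \<comment> \<open>Injectivity is known for the constructed \<open>g\<close>, and \<open>k\<close>
    coincides with \<open>g\<close> on the carrier.\<close>
  show "inj_on k (carrier ?B)"
    if "inj_on f (carrier A)" "k \<in> bilat_hom ?B B'" "\<forall>a\<in>carrier A. k (canon A a) = f a" for k
    using inj[OF that(1)] inj_on_cong[of "carrier ?B" k g] unique[OF that(2,3)] by simp
qed

end
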